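(* Let $G$ be a finitely generated group with finitely generated subgroups $H_1,\ldots,H_n$. For $i=1,\ldots,n$, let $X_i$ be a nontrivial $H_i$-almost invariant subset of $G$. Then, for each $i$, there exists a $K_i$-almost invariant subset $Z_i$ of $G$ (for some subgroup $K_i$ of $G$) which is equivalent to $X_i$, such that the $Z_i$'s are in very good position.
   Context: For a subgroup $H$ of $G$, $H\backslash G$ is the set of cosets $Hg$, on which $G$ acts on the right. Two sets are almost equal if their symmetric difference is finite. A subset $P$ of a set with right $G$-action is almost invariant if $Pg$ is almost equal to $P$ for all $g\in G$. A subset $X\subset G$ is $H$-almost invariant if $hX=X$ for all $h\in H$ and $H\backslash X$ is an almost invariant subset of $H\backslash G$; it is nontrivial if $H\backslash X$ and $H\backslash X^{\ast}$ are both infinite, where $X^{\ast}=G-X$. A subset of $G$ is $H$-finite if it is contained in a finite union of cosets $Hg$. If $X$ is $H$-almost invariant then $gX$ is $gHg^{-1}$-almost invariant. An $H$-almost invariant set $X$ and a $K$-almost invariant set $Y$ are equivalent, $X\sim Y$, if their symmetric difference is $H$-finite. The corners of a pair $(U,V)$ of subsets of $G$ are $U\cap V$, $U^{\ast}\cap V$, $U\cap V^{\ast}$, $U^{\ast}\cap V^{\ast}$. If $U$ is a nontrivial $H$-almost invariant set and $V$ is a nontrivial $K$-almost invariant set, then $U$ and $V$ cross if none of the four corners is $H$-finite (equivalently, none is $K$-finite). $U$ and $V$ are nested if one of the four corners is empty. Let $E(Z_1,\ldots,Z_n)=\{gZ_i,gZ_i^{\ast}:g\in G,1\leq i\leq n\}$.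 The $Z_i$'s are in very good position if any two elements of $E(Z_1,\ldots,Z_n)$ either cross or are nested. *)

theory Defs
  imports "HOL-Algebra.Generated_Groups"
begin

definition finitely_generated :: "('a, 'b) monoid_scheme \<Rightarrow> 'a set \<Rightarrow> bool" where
  "finitely_generated G H \<longleftrightarrow> (\<exists>S. finite S \<and> S \<subseteq> carrier G \<and> generate G S = H)"

definition almost_equal :: "'c set \<Rightarrow> 'c set \<Rightarrow> bool" where
  "almost_equal P Q \<longleftrightarrow> finite (sym_diff P Q)"

(* The set H\A of cosets Hx with x in A. *)
definition coset_image :: "('a, 'b) monoid_scheme \<Rightarrow> 'a set \<Rightarrow> 'a set \<Rightarrow> 'a set set" where
  "coset_image G H A = (\<lambda>x. H #>\<^bsub>G\<^esub> x) ` A"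

(* P is a subset of H\G; the right action sends the coset C = Hx to Cg = Hxg. *)
definition almost_invariant :: "('a, 'b) monoid_scheme \<Rightarrow> 'a set \<Rightarrow> 'a set set \<Rightarrow> bool" where
  "almost_invariant G H P \<longleftrightarrow> P \<subseteq> rcosets\<^bsub>G\<^esub> H \<and>
     (\<forall>g\<in>carrier G. almost_equal ((\<lambda>C. C #>\<^bsub>G\<^esub> g) ` P) P)"

definition H_almost_invariant :: "('a, 'b) monoid_scheme \<Rightarrow> 'a set \<Rightarrow> 'a set \<Rightarrow> bool" where
  "H_almost_invariant G H A \<longleftrightarrow> A \<subseteq> carrier G \<and> (\<forall>h\<in>H. h <#\<^bsub>G\<^esub> A = A) \<and>
     almost_invariant G H (coset_image G H A)"

definition nontrivial_H_almost_invariant ::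
    "('a, 'b) monoid_scheme \<Rightarrow> 'a set \<Rightarrow> 'a set \<Rightarrow> bool" where
  "nontrivial_H_almost_invariant G H A \<longleftrightarrow> H_almost_invariant G H A \<and>
     infinite (coset_image G H A) \<and> infinite (coset_image G H (carrier G - A))"

definition H_finite :: "('a, 'b) monoid_scheme \<Rightarrow> 'a set \<Rightarrow> 'a set \<Rightarrow> bool" where
  "H_finite G H A \<longleftrightarrow>
     (\<exists>F. finite F \<and> F \<subseteq> carrier G \<and> A \<subseteq> (\<Union>g\<in>F. H #>\<^bsub>G\<^esub> g))"

(* Finiteness is measured by the group H of the first set A.  The group of the second set must not
   be used alone: every two subsets of G have a G-finite symmetric difference. *)
definition equivalent_almost_invariant ::
    "('a, 'b) monoid_scheme \<Rightarrow> 'a set \<Rightarrow> 'a set \<Rightarrow> 'a set \<Rightarrow> 'a set \<Rightarrow> bool" where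
  "equivalent_almost_invariant G H A K B \<longleftrightarrow>
     H_almost_invariant G H A \<and> H_almost_invariant G K B \<and> H_finite G H (sym_diff A B)"

definition corners :: "('a, 'b) monoid_scheme \<Rightarrow> 'a set \<Rightarrow> 'a set \<Rightarrow> 'a set set" where
  "corners G U V = {U \<inter> V, (carrier G - U) \<inter> V, U \<inter> (carrier G - V),
     (carrier G - U) \<inter> (carrier G - V)}"

(* Crossing is only meaningful for nontrivial sets, so nontriviality is part of the predicate. *)
definition crosses ::
    "('a, 'b) monoid_scheme \<Rightarrow> 'a set \<Rightarrow> 'a set \<Rightarrow> 'a set \<Rightarrow> 'a set \<Rightarrow> bool" where
  "crosses G H U K V \<longleftrightarrow>
     nontrivial_H_almost_invariant G H U \<and> nontrivial_H_almost_invariant G K V \<and>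
     (\<forall>C\<in>corners G U V. \<not> H_finite G H C)"

definition nested :: "('a, 'b) monoid_scheme \<Rightarrow> 'a set \<Rightarrow> 'a set \<Rightarrow> bool" where
  "nested G U V \<longleftrightarrow> {} \<in> corners G U V"

(* The elements of E(Z_1, ..., Z_n).  As crossing refers to the groups under which the sets are
   almost invariant, gZ_i and gZ_i* are paired with g K_i g^-1. *)
definition translates ::
    "('a, 'b) monoid_scheme \<Rightarrow> nat \<Rightarrow> (nat \<Rightarrow> 'a set) \<Rightarrow> (nat \<Rightarrow> 'a set) \<Rightarrow> ('a set \<times> 'a set) set" where
  "translates G n K Z =
     {(g <#\<^bsub>G\<^esub> K i #>\<^bsub>G\<^esub> inv\<^bsub>G\<^esub> g, U) | g i U. g \<in> carrier G \<and> i \<in> {1..n} \<and>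
        (U = g <#\<^bsub>G\<^esub> Z i \<or> U = g <#\<^bsub>G\<^esub> (carrier G - Z i))}"

definition very_good_position ::
    "('a, 'b) monoid_scheme \<Rightarrow> nat \<Rightarrow> (nat \<Rightarrow> 'a set) \<Rightarrow> (nat \<Rightarrow> 'a set) \<Rightarrow> bool" where
  "very_good_position G n K Z \<longleftrightarrow>
     (\<forall>(S, U) \<in> translates G n K Z. \<forall>(T, V) \<in> translates G n K Z.
        crosses G S U T V \<or> nested G U V)"

end

theory Submission
  imports Defs
begin

text \<open>
  The sets \<open>Z\<^sub>i\<close> are obtained from a vertex of the cubing that is dual to the translates of the given
  sets.  Let \<open>E\<close> be the family of all translates of the sets \<open>A\<^sub>i\<close> and of their complements.  Order it by
  inclusion up to a small error, and order equivalent sets by counting orbits in the two differences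
  (\<open>ai_le\<close>).  This is a \<open>G\<close>-invariant preorder (\<open>ai_le_trans\<close>), it is reversed by complementation, and
  two sets with a small corner are always comparable, possibly after passing to a complement
  (\<open>ai_le_linear\<close>).

  Choose one set from each complementary pair so that the choice \<open>v\<close> is closed upwards, and put
  \<open>Z(U) = {g. g\<^sup>-\<^sup>1U \<in> v}\<close>.  Then \<open>Z\<close> commutes with translation and complementation, and \<open>U \<le> V\<close> implies
  \<open>Z(U) \<subseteq> Z(V)\<close>: sets with a small corner become honestly nested.  The same groups serve, so
  \<open>K\<^sub>i = H\<^sub>i\<close>.

  It remains to choose \<open>v\<close> so that \<open>Z(U)\<close> is equivalent to \<open>U\<close>.  The obvious choice, all sets that
  contain the identity, would give \<open>Z(U) = U\<close> but is closed upwards only for honest inclusion.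
  However, \<open>U \<le> V\<close> without \<open>U \<subseteq> V\<close> is possible only for non-nested pairs (\<open>subset_if_nested_ai_le\<close>),
  and since \<open>G\<close> and the \<open>H\<^sub>i\<close> are finitely generated, the translates of one set that are not nested
  with another one come from finitely many double cosets
  (\<open>nested_outside_finitely_many_double_cosets\<close>).  So the union of all \<open>U - V\<close> with \<open>V \<ge> U\<close> is small
  (\<open>near_Union_excess\<close>).  The sets all of whose larger members contain the identity form a consistent
  upper set, a completion of it serves as \<open>v\<close>, and \<open>U\<close> and \<open>Z(U)\<close> differ only inside the small unions
  belonging to \<open>U\<close> and to its complement (\<open>near_missing\<close>, \<open>near_extra\<close>).
\<close>

section \<open>Counting differences and completing upper sets\<close>

text \<open>
  Both sides count, once each, the points that lie in some but not all of the three sets.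
\<close>
lemma card_diff_cocycle:
  assumes fin: "finite (X - Y)" "finite (Y - X)" "finite (Y - Z)" "finite (Z - Y)"
  shows "card (X - Y) + card (Y - Z) + card (Z - X) = card (Y - X) + card (Z - Y) + card (X - Z)"
proof -
  have split: "card (P - Q) = card (P - Q - R) + card (P \<inter> R - Q)" if "finite (P - Q)" for P Q R :: "'c set"
  proof -
    have "P - Q = (P - Q - R) \<union> (P \<inter> R - Q)" by blast
    moreover have "card ((P - Q - R) \<union> (P \<inter> R - Q)) = card (P - Q - R) + card (P \<inter> R - Q)"
      by (rule card_Un_disjoint) (auto intro: finite_subset[OF _ that])
    ultimately show ?thesis by simp
  qed
  have fin': "finite (X - Z)" "finite (Z - X)"
    using finite_subset[of "X - Z" "(X - Y) \<union> (Y - Z)"] finite_subset[of "Z - X" "(Z - Y) \<union> (Y - X)"] fin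
    by auto
  have e: "X - Y - Z = X - Z - Y" "Y - X - Z = Y - Z - X" "Z - X - Y = Z - Y - X" by auto
  have i: "X \<inter> Y - Z = Y \<inter> X - Z" "Z \<inter> Y - X = Y \<inter> Z - X" "Z \<inter> X - Y = X \<inter> Z - Y" by auto
  show ?thesis
    using split[OF fin(1), of Z] split[OF fin(2), of Z] split[OF fin(3), of X] split[OF fin(4), of X]
      split[OF fin'(1), of Y] split[OF fin'(2), of Y] e i by simp
qed

text \<open>
  A maximal consistent upper set is complete: if neither \<open>x\<close> nor its complement belonged to it, the
  elements above \<open>x\<close> could be added.  This produces the vertices of the cubing of a partially ordered
  set with complementation.
\<close>
lemma complete_upset_extension:
  fixes le :: "'c \<Rightarrow> 'c \<Rightarrow> bool" and star :: "'c \<Rightarrow> 'c"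
  assumes refl: "\<And>x. x \<in> E \<Longrightarrow> le x x"
    and trans: "\<And>x y z. \<lbrakk>x \<in> E; y \<in> E; z \<in> E; le x y; le y z\<rbrakk> \<Longrightarrow> le x z"
    and star_in: "\<And>x. x \<in> E \<Longrightarrow> star x \<in> E"
    and star_star: "\<And>x. x \<in> E \<Longrightarrow> star (star x) = x"
    and anti: "\<And>x y. \<lbrakk>x \<in> E; y \<in> E; le x y\<rbrakk> \<Longrightarrow> le (star y) (star x)"
    and proper: "\<And>x. x \<in> E \<Longrightarrow> \<not> le x (star x)"
    and W: "W \<subseteq> E" "\<And>x y. \<lbrakk>x \<in> W; y \<in> E; le x y\<rbrakk> \<Longrightarrow> y \<in> W" "\<And>x. x \<in> W \<Longrightarrow> star x \<notin> W"
  shows "\<exists>v. W \<subseteq> v \<and> v \<subseteq> E \<and> (\<forall>x\<in>v. \<forall>y\<in>E. le x y \<longrightarrow> y \<in> v) \<and> (\<forall>x\<in>E. (star x \<in> v) = (x \<notin> v))"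
proof -
  define F where "F = {v. W \<subseteq> v \<and> v \<subseteq> E \<and> (\<forall>x\<in>v. \<forall>y\<in>E. le x y \<longrightarrow> y \<in> v) \<and> (\<forall>x\<in>v. star x \<notin> v)}"
  have "W \<in> F" using W by (auto simp: F_def)
  have "\<exists>M\<in>F. \<forall>X\<in>F. M \<subseteq> X \<longrightarrow> X = M"
  proof (rule subset_Zorn_nonempty)
    show "F \<noteq> {}" using \<open>W \<in> F\<close> by auto
    fix C assume C: "C \<noteq> {}" "subset.chain F C"
    have CF: "C \<subseteq> F" and lin: "\<And>X Y. X \<in> C \<Longrightarrow> Y \<in> C \<Longrightarrow> X \<subseteq> Y \<or> Y \<subseteq> X"
      using C(2) by (auto simp: subset_chain_def)
    have "star x \<notin> \<Union>C" if x: "x \<in> \<Union>C" for x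
    proof
      assume "star x \<in> \<Union>C"
      then obtain X where X: "X \<in> C" "x \<in> X" "star x \<in> X" using x lin by blast
      then show False using CF by (auto simp: F_def)
    qed
    moreover have "W \<subseteq> \<Union>C"
    proof -
      obtain X where "X \<in> C" using C(1) by blast
      then have "W \<subseteq> X" using CF by (auto simp: F_def)
      then show ?thesis using \<open>X \<in> C\<close> by blast
    qed
    moreover have "\<Union>C \<subseteq> E" using CF by (auto simp: F_def)
    moreover have "y \<in> \<Union>C" if "x \<in> \<Union>C" "y \<in> E" "le x y" for x y
      using that CF by (auto simp: F_def)
    ultimately show "\<Union>C \<in> F" unfolding F_def by blast
  qed
  then obtain v where v: "v \<in> F" and max: "\<And>X. X \<in> F \<Longrightarrow> v \<subseteq> X \<Longrightarrow> X = v" by blast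
  have vE: "v \<subseteq> E" and up: "\<And>x y. \<lbrakk>x \<in> v; y \<in> E; le x y\<rbrakk> \<Longrightarrow> y \<in> v" and cons: "\<And>x. x \<in> v \<Longrightarrow> star x \<notin> v"
    and Wv: "W \<subseteq> v"
    using v by (auto simp: F_def)
  have "x \<in> v" if x: "x \<in> E" and nx: "star x \<notin> v" for x
  proof -
    define X where "X = v \<union> {y \<in> E. le x y}"
    have "star y \<notin> X" if "y \<in> X" for y
    proof
      assume "star y \<in> X"
      have y: "y \<in> E" using that vE by (auto simp: X_def)
      have a: "star x \<in> v" if "z \<in> v" "z \<in> E" "le x (star z)" for z
        using up[OF that(1) star_in[OF x]] anti[OF x star_in[OF that(2)] that(3)] star_star[OF that(2)]
        by simp
      consider "y \<in> v" "star y \<in> v" | "y \<in> v" "le x (star y)" | "star y \<in> v" "le x y" | "le x y" "le x (star y)"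
        using \<open>star y \<in> X\<close> \<open>y \<in> X\<close> by (auto simp: X_def)
      then show False
      proof cases
        case 1 then show ?thesis using cons by blast
      next
        case 2 then show ?thesis using a[of y] nx y by blast
      next
        case 3 then show ?thesis using a[of "star y"] nx y star_in star_star by auto
      next
        case 4
        have "le y (star x)" using anti[OF x star_in[OF y] 4(2)] star_star y by simp
        then show ?thesis using trans[OF x y star_in[OF x] 4(1)] proper x by blast
      qed
    qed
    moreover have "z \<in> X" if "y \<in> X" "z \<in> E" "le y z" for y z
      using that up trans[of x y z] x by (auto simp: X_def)
    moreover have "W \<subseteq> X" "X \<subseteq> E" using Wv vE by (auto simp: X_def)
    ultimately have "X \<in> F" by (simp add: F_def)
    then have "X = v" using max by (auto simp: X_def)
    then show ?thesis using x refl by (auto simp: X_def)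
  qed
  then have "\<forall>x\<in>E. (star x \<in> v) = (x \<notin> v)" using cons by blast
  with Wv vE up show ?thesis by (intro exI[of _ v]) simp
qed

section \<open>Bounded distance in a group\<close>

context group
begin

text \<open>
  For a finitely generated group this says that \<open>X\<close> lies in a bounded neighbourhood of \<open>Y\<close> for the
  left-invariant word metric.  Being \<open>H\<close>-finite is the case \<open>Y = H\<close>, and almost invariance bounds the
  distance of boundary points to \<open>H\<close>; writing both with one transitive relation turns most arguments
  about corners into short chains.
\<close>
definition near :: "'a set \<Rightarrow> 'a set \<Rightarrow> bool" where
  "near X Y \<longleftrightarrow> X \<subseteq> carrier G \<and>
     (\<exists>F. finite F \<and> F \<subseteq> carrier G \<and> (\<forall>p\<in>X. \<exists>f\<in>F. p \<otimes> f \<in> Y))"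

lemma nearI:
  assumes "X \<subseteq> carrier G" "finite F" "F \<subseteq> carrier G" "\<And>p. p \<in> X \<Longrightarrow> \<exists>f\<in>F. p \<otimes> f \<in> Y"
  shows "near X Y"
  using assms unfolding near_def by blast

lemma nearE:
  assumes "near X Y"
  obtains F where "X \<subseteq> carrier G" "finite F" "F \<subseteq> carrier G" "\<And>p. p \<in> X \<Longrightarrow> \<exists>f\<in>F. p \<otimes> f \<in> Y"
  using assms unfolding near_def by blast

lemma near_mono: "\<lbrakk>near X Y; X' \<subseteq> X; Y \<subseteq> Y'\<rbrakk> \<Longrightarrow> near X' Y'"
  unfolding near_def by (meson subset_iff)

lemma near_trans:
  assumes "near X Y" "near Y Z" shows "near X Z"
proof -
  obtain F where F: "X \<subseteq> carrier G" "finite F" "F \<subseteq> carrier G" "\<And>p. p \<in> X \<Longrightarrow> \<exists>f\<in>F. p \<otimes> f \<in> Y"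
    using nearE[OF assms(1)] by metis
  obtain F' where F': "finite F'" "F' \<subseteq> carrier G" "\<And>p. p \<in> Y \<Longrightarrow> \<exists>f\<in>F'. p \<otimes> f \<in> Z"
    using nearE[OF assms(2)] by metis
  show ?thesis
  proof (rule nearI[of _ "(\<lambda>(f, f'). f \<otimes> f') ` (F \<times> F')"])
    fix p assume p: "p \<in> X"
    obtain f where f: "f \<in> F" "p \<otimes> f \<in> Y" using F p by blast
    obtain f' where f': "f' \<in> F'" "p \<otimes> f \<otimes> f' \<in> Z" using F' f by blast
    have "p \<otimes> (f \<otimes> f') \<in> Z" using f f' F F' p by (metis m_assoc subsetD)
    then show "\<exists>f\<in>(\<lambda>(f, f'). f \<otimes> f') ` (F \<times> F'). p \<otimes> f \<in> Z" using f f' by force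
  qed (use F F' in auto)
qed

lemma near_UN:
  assumes "finite I" "\<And>i. i \<in> I \<Longrightarrow> near (X i) Y"
  shows "near (\<Union>i\<in>I. X i) Y"
proof -
  have "\<forall>i\<in>I. \<exists>F. finite F \<and> F \<subseteq> carrier G \<and> (\<forall>p\<in>X i. \<exists>f\<in>F. p \<otimes> f \<in> Y)"
    using assms unfolding near_def by blast
  then obtain F where F: "\<And>i. i \<in> I \<Longrightarrow> finite (F i) \<and> F i \<subseteq> carrier G \<and> (\<forall>p\<in>X i. \<exists>f\<in>F i. p \<otimes> f \<in> Y)"
    by metis
  show ?thesis
    by (rule nearI[of _ "\<Union>i\<in>I. F i"]) (use F assms in \<open>auto simp: near_def, blast+\<close>)
qed

lemma near_Un: "\<lbrakk>near X Z; near Y Z\<rbrakk> \<Longrightarrow> near (X \<union> Y) Z"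
  using near_UN[of "UNIV :: bool set" "\<lambda>b. if b then X else Y" Z] by (simp add: UNIV_bool Un_ac(3))

lemma near_Un_split:
  assumes "near X (Y \<union> Z)"
  obtains X1 X2 where "X = X1 \<union> X2" "near X1 Y" "near X2 Z"
proof -
  obtain F where F: "X \<subseteq> carrier G" "finite F" "F \<subseteq> carrier G" "\<And>p. p \<in> X \<Longrightarrow> \<exists>f\<in>F. p \<otimes> f \<in> Y \<union> Z"
    using nearE[OF assms] by metis
  show thesis
  proof (rule that[of "{p\<in>X. \<exists>f\<in>F. p \<otimes> f \<in> Y}" "{p\<in>X. \<exists>f\<in>F. p \<otimes> f \<in> Z}"])
    show "X = {p \<in> X. \<exists>f\<in>F. p \<otimes> f \<in> Y} \<union> {p \<in> X. \<exists>f\<in>F. p \<otimes> f \<in> Z}" using F(4) by blast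
  qed (rule nearI[of _ F]; use F in auto)+
qed

lemma near_refl: "X \<subseteq> carrier G \<Longrightarrow> near X X"
  by (rule nearI[of _ "{\<one>}"]) auto

lemma near_orbit:
  assumes "H \<subseteq> carrier G" "x \<in> carrier G" "\<And>h. h \<in> H \<Longrightarrow> h \<otimes> x \<in> X"
  shows "near H X"
  by (rule nearI[of _ "{x}"]) (use assms in auto)

lemma H_finite_iff_near:
  assumes H: "subgroup H G"
  shows "H_finite G H X \<longleftrightarrow> near X H"
proof
  assume "H_finite G H X"
  then obtain F where F: "finite F" "F \<subseteq> carrier G" "X \<subseteq> (\<Union>g\<in>F. H #> g)" by (auto simp: H_finite_def)
  have HG: "H \<subseteq> carrier G" using H subgroup.subset by blast
  show "near X H"
  proof (rule nearI[of _ "m_inv G ` F"])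
    show "X \<subseteq> carrier G" using F r_coset_subset_G[OF HG] by blast
    fix p assume "p \<in> X"
    then obtain g h where "g \<in> F" "h \<in> H" "p = h \<otimes> g" using F by (auto simp: r_coset_def)
    then have "p \<otimes> inv g = h" using F HG by (metis inv_solve_right' m_closed subsetD)
    then show "\<exists>f\<in>m_inv G ` F. p \<otimes> f \<in> H" using \<open>g \<in> F\<close> \<open>h \<in> H\<close> by blast
  qed (use F in auto)
next
  assume "near X H"
  then obtain F where F: "X \<subseteq> carrier G" "finite F" "F \<subseteq> carrier G" "\<And>p. p \<in> X \<Longrightarrow> \<exists>f\<in>F. p \<otimes> f \<in> H"
    using nearE by metis
  have "X \<subseteq> (\<Union>g\<in>m_inv G ` F. H #> g)"
  proof
    fix p assume p: "p \<in> X"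
    then obtain f where f: "f \<in> F" "p \<otimes> f \<in> H" using F by blast
    then have "p = (p \<otimes> f) \<otimes> inv f" using F p by (metis inv_solve_right m_closed subsetD)
    then show "p \<in> (\<Union>g\<in>m_inv G ` F. H #> g)" using f by (auto simp: r_coset_def)
  qed
  then show "H_finite G H X" unfolding H_finite_def using F by (intro exI[of _ "m_inv G ` F"]) auto
qed

lemma finite_coset_image_iff:
  assumes H: "subgroup H G" and X: "X \<subseteq> carrier G"
  shows "finite (coset_image G H X) \<longleftrightarrow> near X H"
proof
  have HG: "H \<subseteq> carrier G" using H subgroup.subset by blast
  assume "finite (coset_image G H X)"
  then obtain F where F: "finite F" "F \<subseteq> X" "coset_image G H X = (\<lambda>x. H #> x) ` F"
    unfolding coset_image_def by (metis finite_subset_image subset_refl)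
  have "X \<subseteq> (\<Union>g\<in>F. H #> g)"
  proof
    fix x assume x: "x \<in> X"
    then have "H #> x \<in> (\<lambda>x. H #> x) ` F" using F(3) imageI[OF x, of "\<lambda>x. H #> x"] by (simp add: coset_image_def)
    then obtain f where "f \<in> F" "H #> x = H #> f" by blast
    then show "x \<in> (\<Union>g\<in>F. H #> g)" using rcos_self[of x H] x X H by blast
  qed
  moreover have "F \<subseteq> carrier G" using F(2) X by blast
  ultimately have "H_finite G H X" using F(1) by (auto simp: H_finite_def)
  then show "near X H" using H_finite_iff_near[OF H] by simp
next
  assume "near X H"
  then obtain F where F: "finite F" "F \<subseteq> carrier G" "X \<subseteq> (\<Union>g\<in>F. H #> g)"
    using H_finite_iff_near[OF H, of X] unfolding H_finite_def by blast
  have "coset_image G H X \<subseteq> (\<lambda>x. H #> x) ` F"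
  proof
    fix C assume "C \<in> coset_image G H X"
    then obtain x where x: "x \<in> X" "C = H #> x" by (auto simp: coset_image_def)
    then obtain g where g: "g \<in> F" "x \<in> H #> g" using F by blast
    then have "C = H #> g" using repr_independence[of x H g] F H x by auto
    then show "C \<in> (\<lambda>x. H #> x) ` F" using g by blast
  qed
  then show "finite (coset_image G H X)" by (rule finite_subset) (use F in simp)
qed

text \<open>
  A nonempty intersection of a coset of \<open>S\<close> with a coset of \<open>T\<close> is a coset of \<open>S \<inter> T\<close>, so finitely many
  pairs of cosets give finitely many cosets of the intersection.
\<close>
lemma near_Int:
  assumes S: "subgroup S G" and T: "subgroup T G" and XS: "near X S" and XT: "near X T"
  shows "near X (S \<inter> T)"
proof -
  have X: "X \<subseteq> carrier G" using XS by (auto simp: near_def)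
  have ST: "subgroup (S \<inter> T) G" using S T subgroups_Inter_pair by blast
  have rep: "R #> x = R #> y \<longleftrightarrow> x \<otimes> inv y \<in> R" if "subgroup R G" "x \<in> X" "y \<in> X" for R x y
  proof
    assume "R #> x = R #> y"
    then have "x \<in> R #> y" using rcos_self[OF _ that(1), of x] X that by auto
    then obtain r where "r \<in> R" "x = r \<otimes> y" by (auto simp: r_coset_def)
    then show "x \<otimes> inv y \<in> R" using X that subgroup.mem_carrier[OF that(1)]
      by (metis inv_solve_right' m_closed subsetD)
  next
    assume "x \<otimes> inv y \<in> R"
    moreover have "x = (x \<otimes> inv y) \<otimes> y" using X that by (simp add: m_assoc subset_iff)
    ultimately have "x \<in> R #> y" by (auto simp: r_coset_def)
    then show "R #> x = R #> y" using repr_independence[of x R y] X that by auto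
  qed
  let ?f = "\<lambda>x. (S #> x, T #> x)"
  have fin: "finite (?f ` X)"
    using finite_coset_image_iff[OF S X] finite_coset_image_iff[OF T X] XS XT
    by (auto simp: coset_image_def intro: finite_subset[of _ "(\<lambda>x. S #> x) ` X \<times> (\<lambda>x. T #> x) ` X"])
  obtain F where F: "finite F" "F \<subseteq> X" "?f ` X = ?f ` F"
    using finite_subset_image[OF fin subset_refl] by blast
  have "coset_image G (S \<inter> T) X \<subseteq> (\<lambda>x. (S \<inter> T) #> x) ` F"
  proof
    fix C assume "C \<in> coset_image G (S \<inter> T) X"
    then obtain x where x: "x \<in> X" "C = (S \<inter> T) #> x" by (auto simp: coset_image_def)
    then obtain y where y: "y \<in> F" "?f x = ?f y" using F(3) by (metis (no_types, lifting) imageE imageI)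
    then have "y \<in> X" using F(2) by blast
    then have "(S \<inter> T) #> x = (S \<inter> T) #> y"
      using y(2) rep[OF S x(1)] rep[OF T x(1)] rep[OF ST x(1)] by blast
    then show "C \<in> (\<lambda>x. (S \<inter> T) #> x) ` F" using x y by blast
  qed
  then have "finite (coset_image G (S \<inter> T) X)" by (rule finite_subset) (use F in simp)
  then show ?thesis using finite_coset_image_iff[OF ST X] by simp
qed

section \<open>Almost invariant sets by distances\<close>

text \<open>
  Nontrivial almost invariance, with cosets replaced by distances; see \<open>essential_iff\<close>.
\<close>
definition essential :: "'a set \<Rightarrow> 'a set \<Rightarrow> bool" where
  "essential H U \<longleftrightarrow> subgroup H G \<and> U \<subseteq> carrier G \<and> (\<forall>h\<in>H. \<forall>u\<in>U. h \<otimes> u \<in> U) \<and>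
     (\<forall>g\<in>carrier G. near {p \<in> U. p \<otimes> g \<notin> U} H) \<and>
     \<not> near U H \<and> \<not> near (carrier G - U) H"

lemma essentialD:
  assumes "essential H U"
  shows "subgroup H G" "U \<subseteq> carrier G" "\<And>h u. \<lbrakk>h \<in> H; u \<in> U\<rbrakk> \<Longrightarrow> h \<otimes> u \<in> U"
    "\<And>g. g \<in> carrier G \<Longrightarrow> near {p \<in> U. p \<otimes> g \<notin> U} H"
    "\<not> near U H" "\<not> near (carrier G - U) H" "H \<subseteq> carrier G"
  using assms subgroup.subset unfolding essential_def by blast+

lemma near_shift:
  assumes "X \<subseteq> carrier G" "g \<in> carrier G" "\<And>p. p \<in> X \<Longrightarrow> p \<otimes> g \<in> Y"
  shows "near X Y"
  by (rule nearI[of _ "{g}"]) (use assms in auto)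

lemma essential_complement:
  assumes U: "essential H U" shows "essential H (carrier G - U)"
proof -
  note D = essentialD[OF U]
  have "h \<otimes> u \<in> carrier G - U" if "h \<in> H" "u \<in> carrier G - U" for h u
  proof -
    have "u \<in> U" if "h \<otimes> u \<in> U"
      using D(3)[OF subgroup.m_inv_closed[OF D(1) \<open>h \<in> H\<close>] that] \<open>h \<in> H\<close> \<open>u \<in> carrier G - U\<close> D(7)
      by (simp add: inv_solve_left subset_iff m_assoc[symmetric])
    then show ?thesis using that D by auto
  qed
  moreover have "near {p \<in> carrier G - U. p \<otimes> g \<notin> carrier G - U} H" if g: "g \<in> carrier G" for g
  proof (rule near_trans)
    show "near {p \<in> carrier G - U. p \<otimes> g \<notin> carrier G - U} {p \<in> U. p \<otimes> inv g \<notin> U}"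
      by (rule near_shift[OF _ g]) (use g in \<open>auto simp: m_assoc\<close>)
    show "near {p \<in> U. p \<otimes> inv g \<notin> U} H" using D(4) g by simp
  qed
  moreover have "carrier G - (carrier G - U) = U" using D(2) by auto
  ultimately show ?thesis using D unfolding essential_def by auto
qed

lemma coset_image_r_coset:
  assumes "subgroup H G" "X \<subseteq> carrier G" "g \<in> carrier G"
  shows "(\<lambda>C. C #> g) ` coset_image G H X = coset_image G H (X #> g)"
proof -
  have "H #> x #> g = H #> (x \<otimes> g)" if "x \<in> X" for x
    using coset_mult_assoc[of H x g] assms that subgroup.subset by blast
  then show ?thesis by (force simp: coset_image_def image_image r_coset_def[of G X g])
qed

lemma coset_image_mem_iff:
  assumes H: "subgroup H G" and X: "X \<subseteq> carrier G" "\<And>h x. \<lbrakk>h \<in> H; x \<in> X\<rbrakk> \<Longrightarrow> h \<otimes> x \<in> X"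
    and y: "y \<in> carrier G"
  shows "H #> y \<in> coset_image G H X \<longleftrightarrow> y \<in> X"
proof
  assume "H #> y \<in> coset_image G H X"
  then obtain x where x: "x \<in> X" "H #> y = H #> x" by (auto simp: coset_image_def)
  then have "y \<in> H #> x" using rcos_self[OF y H] by simp
  then show "y \<in> X" using X x by (auto simp: r_coset_def)
qed (auto simp: coset_image_def)

lemma coset_image_Diff:
  assumes H: "subgroup H G"
    and X: "X \<subseteq> carrier G" and Y: "Y \<subseteq> carrier G" "\<And>h x. \<lbrakk>h \<in> H; x \<in> Y\<rbrakk> \<Longrightarrow> h \<otimes> x \<in> Y"
  shows "coset_image G H (X - Y) = coset_image G H X - coset_image G H Y"
proof -
  have "C \<in> coset_image G H (X - Y) \<longleftrightarrow> C \<in> coset_image G H X \<and> C \<notin> coset_image G H Y" for C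
    using coset_image_mem_iff[OF H Y] X unfolding coset_image_def[of G H X] coset_image_def[of G H "X - Y"]
    by auto
  then show ?thesis by blast
qed

lemma l_coset_subset_iff:
  assumes "subgroup H G" "X \<subseteq> carrier G"
  shows "(\<forall>h\<in>H. h <# X = X) \<longleftrightarrow> (\<forall>h\<in>H. \<forall>x\<in>X. h \<otimes> x \<in> X)"
proof
  assume *: "\<forall>h\<in>H. \<forall>x\<in>X. h \<otimes> x \<in> X"
  have "X \<subseteq> h <# X" if "h \<in> H" for h
  proof
    fix x assume "x \<in> X"
    then have "inv h \<otimes> x \<in> X" using * that subgroup.m_inv_closed[OF assms(1)] by blast
    moreover have "x \<in> carrier G" "h \<in> carrier G"
      using \<open>x \<in> X\<close> assms(2) subgroup.mem_carrier[OF assms(1) that] by auto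
    then have "x = h \<otimes> (inv h \<otimes> x)" by (simp add: m_assoc[symmetric])
    ultimately show "x \<in> h <# X" by (auto simp: l_coset_def)
  qed
  then show "\<forall>h\<in>H. h <# X = X" using * by (auto simp: l_coset_def)
qed (auto simp: l_coset_def)

lemma H_almost_invariant_iff:
  assumes H: "subgroup H G"
  shows "H_almost_invariant G H U \<longleftrightarrow> U \<subseteq> carrier G \<and> (\<forall>h\<in>H. \<forall>u\<in>U. h \<otimes> u \<in> U) \<and>
     (\<forall>g\<in>carrier G. near {p \<in> U. p \<otimes> g \<notin> U} H)"
proof (cases "U \<subseteq> carrier G \<and> (\<forall>h\<in>H. \<forall>u\<in>U. h \<otimes> u \<in> U)")
  case True
  then have U: "U \<subseteq> carrier G" "\<And>h u. \<lbrakk>h \<in> H; u \<in> U\<rbrakk> \<Longrightarrow> h \<otimes> u \<in> U" by auto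
  have HG: "H \<subseteq> carrier G" using H subgroup.subset by blast
  have Ug: "U #> g \<subseteq> carrier G" "\<And>h u. \<lbrakk>h \<in> H; u \<in> U #> g\<rbrakk> \<Longrightarrow> h \<otimes> u \<in> U #> g" if "g \<in> carrier G" for g
  proof -
    show "U #> g \<subseteq> carrier G" using U that r_coset_subset_G by blast
    fix h u assume h: "h \<in> H" and "u \<in> U #> g"
    then obtain x where x: "x \<in> U" "u = x \<otimes> g" by (auto simp: r_coset_def)
    then have "h \<otimes> u = (h \<otimes> x) \<otimes> g" using h HG U that by (auto simp: m_assoc subset_iff)
    then show "h \<otimes> u \<in> U #> g" using U(2)[OF h x(1)] by (auto simp: r_coset_def)
  qed
  have eq: "sym_diff (coset_image G H (U #> g)) (coset_image G H U) =
      coset_image G H ((U #> g) - U) \<union> coset_image G H (U - (U #> g))" if "g \<in> carrier G" for g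
    using coset_image_Diff[OF H Ug(1)[OF that] U] coset_image_Diff[OF H U(1) Ug[OF that]] by auto
  have 1: "near ((U #> g) - U) H \<longleftrightarrow> near {p \<in> U. p \<otimes> g \<notin> U} H" (is "near ?A H = near ?B H") if g: "g \<in> carrier G" for g
  proof -
    have "near ?A ?B"
    proof (rule near_shift[of _ "inv g"])
      fix p assume "p \<in> ?A"
      then obtain u where u: "u \<in> U" "p = u \<otimes> g" "u \<otimes> g \<notin> U" by (auto simp: r_coset_def)
      then have "p \<otimes> inv g = u" using g U by (auto simp: m_assoc)
      then show "p \<otimes> inv g \<in> ?B" using u by simp
    qed (use g Ug(1)[OF g] in auto)
    moreover have "near ?B ?A"
      by (rule near_shift[OF _ g]) (use U g in \<open>auto simp: r_coset_def\<close>)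
    ultimately show ?thesis using near_trans by blast
  qed
  have 2: "U - (U #> g) = {p \<in> U. p \<otimes> inv g \<notin> U}" if g: "g \<in> carrier G" for g
  proof -
    have "p \<in> U #> g \<longleftrightarrow> p \<otimes> inv g \<in> U" if "p \<in> U" for p
    proof
      assume "p \<in> U #> g"
      then show "p \<otimes> inv g \<in> U" using U g by (auto simp: r_coset_def m_assoc subset_iff)
    next
      assume "p \<otimes> inv g \<in> U"
      moreover have "p = (p \<otimes> inv g) \<otimes> g" using U g that by (auto simp: m_assoc subset_iff)
      ultimately show "p \<in> U #> g" by (auto simp: r_coset_def)
    qed
    then show ?thesis by blast
  qed
  have "almost_equal ((\<lambda>C. C #> g) ` coset_image G H U) (coset_image G H U) \<longleftrightarrow>
      near {p \<in> U. p \<otimes> g \<notin> U} H \<and> near {p \<in> U. p \<otimes> inv g \<notin> U} H" if g: "g \<in> carrier G" for g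
  proof -
    have "(U #> g) - U \<subseteq> carrier G" "U - (U #> g) \<subseteq> carrier G" using Ug(1)[OF g] U by auto
    from finite_coset_image_iff[OF H this(1)] finite_coset_image_iff[OF H this(2)]
    show ?thesis
      unfolding almost_equal_def coset_image_r_coset[OF H U(1) g] eq[OF g] finite_Un
      by (simp add: 1[OF g] 2[OF g])
  qed
  moreover have "coset_image G H U \<subseteq> rcosets H" using U by (auto simp: coset_image_def RCOSETS_def)
  moreover have "\<forall>h\<in>H. h <# U = U" using True l_coset_subset_iff[OF H U(1)] by blast
  ultimately have "H_almost_invariant G H U \<longleftrightarrow>
      (\<forall>g\<in>carrier G. near {p \<in> U. p \<otimes> g \<notin> U} H \<and> near {p \<in> U. p \<otimes> inv g \<notin> U} H)"
    using U(1) unfolding H_almost_invariant_def almost_invariant_def by simp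
  also have "\<dots> \<longleftrightarrow> (\<forall>g\<in>carrier G. near {p \<in> U. p \<otimes> g \<notin> U} H)" using inv_closed by blast
  finally show ?thesis using True by simp
next
  case False
  then have "\<not> (U \<subseteq> carrier G \<and> (\<forall>h\<in>H. h <# U = U))" using l_coset_subset_iff[OF H, of U] by blast
  then have "\<not> H_almost_invariant G H U" by (simp add: H_almost_invariant_def)
  then show ?thesis using False by blast
qed

lemma essential_iff:
  assumes "subgroup H G"
  shows "essential H U \<longleftrightarrow> nontrivial_H_almost_invariant G H U"
proof (cases "U \<subseteq> carrier G")
  case True
  then show ?thesis
    using H_almost_invariant_iff[OF assms, of U] finite_coset_image_iff[OF assms True]
      finite_coset_image_iff[OF assms, of "carrier G - U"] assms
    by (simp add: essential_def nontrivial_H_almost_invariant_def)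
next
  case False
  then show ?thesis
    by (simp add: essential_def nontrivial_H_almost_invariant_def H_almost_invariant_def)
qed

section \<open>Small corners\<close>

text \<open>
  This is how almost invariance is used: points of \<open>U\<close> from which a bounded step leaves \<open>U\<close> are near
  the stabilising group.
\<close>
lemma near_boundary:
  assumes U: "essential H U" and X: "X \<subseteq> U" "near X (carrier G - U)"
  shows "near X H"
proof -
  obtain F where F: "finite F" "F \<subseteq> carrier G" "\<And>p. p \<in> X \<Longrightarrow> \<exists>f\<in>F. p \<otimes> f \<in> carrier G - U"
    using nearE[OF X(2)] by metis
  have "near (\<Union>f\<in>F. {p \<in> U. p \<otimes> f \<notin> U}) H"
    by (rule near_UN[OF F(1)]) (use essentialD(4)[OF U] F(2) in auto)
  then show ?thesis by (rule near_mono) (use F(3) X(1) in auto)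
qed

text \<open>
  As \<open>U\<close> is not \<open>H\<close>-finite, some point \<open>x\<close> of \<open>U\<close> lies farther from \<open>H\<close> than all of \<open>X\<close> does; its
  orbit \<open>Hx\<close> stays in \<open>U\<close> and at that distance from \<open>H\<close>.  Hence every small part of \<open>U\<close> can be
  removed, and \<open>H\<close> is still near what remains.
\<close>
lemma near_deep_part:
  assumes U: "essential H U" and X: "near X H"
  shows "near H (U - X)"
proof -
  note D = essentialD[OF U]
  obtain F where F: "finite F" "F \<subseteq> carrier G" "\<And>p. p \<in> X \<Longrightarrow> \<exists>f\<in>F. p \<otimes> f \<in> H"
    using nearE[OF X] by metis
  obtain x where x: "x \<in> U" "\<And>f. f \<in> F \<Longrightarrow> x \<otimes> f \<notin> H"
    using D(5) nearI[OF D(2) F(1,2)] by metis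
  have xG: "x \<in> carrier G" using x D by auto
  show ?thesis
  proof (rule near_orbit[OF D(7) xG])
    fix h assume h: "h \<in> H"
    have hG: "h \<in> carrier G" using h D by auto
    have "h \<otimes> x \<notin> X"
    proof
      assume "h \<otimes> x \<in> X"
      then obtain f where f: "f \<in> F" "h \<otimes> x \<otimes> f \<in> H" using F(3) by blast
      then have fG: "f \<in> carrier G" using F(2) by blast
      have "inv h \<otimes> (h \<otimes> x \<otimes> f) \<in> H"
        using subgroup.m_closed[OF D(1)] subgroup.m_inv_closed[OF D(1) h] f(2) by blast
      moreover have "inv h \<otimes> (h \<otimes> x \<otimes> f) = x \<otimes> f" using hG xG fG by (simp add: m_assoc[symmetric])
      ultimately show False using x(2) f(1) by simp
    qed
    then show "h \<otimes> x \<in> U - X" using D(3) h x(1) by blast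
  qed
qed

text \<open>
  A corner is measured alike by both groups, which is why the definition of crossing is symmetric.
  A part of \<open>U \<inter> V\<close> that is near \<open>S\<close> is near the deep part of \<open>U\<close>, which avoids \<open>V\<close>; so it consists
  of points of \<open>V\<close> near the complement of \<open>V\<close>, and these are near \<open>T\<close>.
\<close>
lemma small_sym:
  assumes U: "essential S U" and V: "essential T V" and small: "near (U \<inter> V) S"
  shows "near (U \<inter> V) T"
proof (rule near_boundary[OF V])
  have "near S (U - U \<inter> V)" by (rule near_deep_part[OF U small])
  then have "near S (carrier G - V)" by (rule near_mono) (use essentialD(2)[OF U] in auto)
  then show "near (U \<inter> V) (carrier G - V)" by (rule near_trans[OF small])
qed simp

lemma small_diff_sym:
  assumes U: "essential S U" and V: "essential T V"
  shows "near (U - V) S \<longleftrightarrow> near (U - V) T"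
proof -
  have e: "U - V = U \<inter> (carrier G - V)" "U - V = (carrier G - V) \<inter> U" using essentialD(2)[OF U] by auto
  show ?thesis
    using small_sym[OF U essential_complement[OF V]] small_sym[OF essential_complement[OF V] U] e by metis
qed

text \<open>
  The set \<open>U - W\<close> is near \<open>T\<close>, and \<open>T\<close> is near the deep part of \<open>V\<close>, which lies in \<open>W\<close>.  So \<open>U - W\<close>
  consists of points outside \<open>W\<close> that are near \<open>W\<close>.
\<close>
lemma small_diff_trans:
  assumes U: "essential S U" and V: "essential T V" and W: "essential R W"
    and UV: "near (U - V) S" and VW: "near (V - W) T"
  shows "near (U - W) S"
proof -
  have "near ((U - V) \<union> (V - W)) T" using near_Un VW UV small_diff_sym[OF U V] by blast
  then have UW: "near (U - W) T" by (rule near_mono) auto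
  have "near T W" by (rule near_mono[OF near_deep_part[OF V VW]]) auto
  then have "near (U - W) (carrier G - (carrier G - W))"
    using near_trans[OF UW] essentialD(2)[OF W] by (simp add: double_diff)
  then have "near (U - W) R"
    by (rule near_boundary[OF essential_complement[OF W], rotated]) (use essentialD(2)[OF U] in auto)
  then show ?thesis using small_diff_sym[OF U W] by simp
qed

text \<open>
  The group \<open>S\<close> is near both sides of \<open>U\<close>.  A point of \<open>S\<close> in \<open>V\<close> is near a point outside \<open>U\<close>, which is
  either in \<open>V - U\<close>, hence near \<open>T\<close>, or outside \<open>V\<close>, and then the boundary of \<open>V\<close> is passed on the way.
  The points of \<open>S\<close> outside \<open>V\<close> are treated in the same way with complements.
\<close>
lemma commensurable_if_equivalent:
  assumes U: "essential S U" and V: "essential T V" and UV: "near (U - V) T" "near (V - U) T"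
  shows "near S T"
proof -
  note DU = essentialD[OF U] and DV = essentialD[OF V]
  have half: "near (S \<inter> V') T"
    if V': "essential T V'" and U': "essential S U'" and d: "near (V' - U') T" for U' V'
  proof -
    have "near {} S" by (rule nearI[of _ "{}"]) auto
    from near_deep_part[OF essential_complement[OF U'] this]
    \<comment> \<open>\<open>S\<close> is near the complement of \<open>U'\<close>, which is split here along \<open>V'\<close>.\<close>
    have "near (S \<inter> V') ((V' - U') \<union> (carrier G - V'))" by (rule near_mono) auto
    then obtain X Y where XY: "S \<inter> V' = X \<union> Y" "near X (V' - U')" "near Y (carrier G - V')"
      by (rule near_Un_split)
    have "near X T" by (rule near_trans[OF XY(2) d])
    moreover have "near Y T" by (rule near_boundary[OF V' _ XY(3)]) (use XY(1) in auto)
    ultimately show ?thesis using near_Un XY(1) by simp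
  qed
  have "(carrier G - V) - (carrier G - U) = U - V" using DU by auto
  then have "near (S \<inter> V) T" "near (S \<inter> (carrier G - V)) T"
    using half[OF V U UV(2)] half[OF essential_complement[OF V] essential_complement[OF U]] UV(1) by simp_all
  then have "near ((S \<inter> V) \<union> (S \<inter> (carrier G - V))) T" by (rule near_Un)
  then show ?thesis by (rule near_mono) (use DU in auto)
qed

section \<open>Counting orbits\<close>

definition orbits :: "'a set \<Rightarrow> 'a set \<Rightarrow> nat" where
  "orbits L X = card (coset_image G L X)"

text \<open>
  Each \<open>L\<close>-orbit in \<open>X\<close> splits into as many \<open>M\<close>-orbits as \<open>L\<close> itself does, because right translation
  carries \<open>L\<close> to any of its cosets.
\<close>
lemma orbits_index:
  assumes L: "subgroup L G" and M: "subgroup M G" "M \<subseteq> L" "near L M"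
    and X: "X \<subseteq> carrier G" "\<And>l x. \<lbrakk>l \<in> L; x \<in> X\<rbrakk> \<Longrightarrow> l \<otimes> x \<in> X" "near X L"
  shows "orbits M X = orbits M L * orbits L X"
proof -
  have LG: "L \<subseteq> carrier G" and MG: "M \<subseteq> carrier G" using L M subgroup.subset by blast+
  have finX: "finite (coset_image G L X)" using finite_coset_image_iff[OF L X(1)] X(3) by simp
  have finL: "finite (coset_image G M L)" using finite_coset_image_iff[OF M(1) LG] M(3) by simp
  have sub: "C \<subseteq> X" if "C \<in> coset_image G L X" for C
    using that X(2) by (auto simp: coset_image_def r_coset_def)
  have UN: "coset_image G M X = (\<Union>C\<in>coset_image G L X. coset_image G M C)"
  proof
    show "coset_image G M X \<subseteq> (\<Union>C\<in>coset_image G L X. coset_image G M C)"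
    proof
      fix D assume "D \<in> coset_image G M X"
      then obtain x where x: "x \<in> X" "D = M #> x" by (auto simp: coset_image_def)
      have "x \<in> L #> x" using rcos_self[OF _ L] x X by blast
      then show "D \<in> (\<Union>C\<in>coset_image G L X. coset_image G M C)" using x by (auto simp: coset_image_def)
    qed
    show "(\<Union>C\<in>coset_image G L X. coset_image G M C) \<subseteq> coset_image G M X"
      using sub by (auto simp: coset_image_def)
  qed
  have each: "finite (coset_image G M C) \<and> card (coset_image G M C) = orbits M L" if C: "C \<in> coset_image G L X" for C
  proof -
    obtain a where a: "a \<in> X" "C = L #> a" using C by (auto simp: coset_image_def)
    have aG: "a \<in> carrier G" using a X by auto
    have "coset_image G M C = (\<lambda>D. D #> a) ` coset_image G M L"
      using coset_image_r_coset[OF M(1) LG aG] a by simp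
    moreover have "inj_on (\<lambda>D. D #> a) (coset_image G M L)"
    proof (rule inj_on_inverseI)
      fix D assume "D \<in> coset_image G M L"
      then have "D \<subseteq> carrier G" using r_coset_subset_G[OF MG] LG by (auto simp: coset_image_def)
      then show "D #> a #> inv a = D" using aG by (simp add: coset_mult_assoc coset_mult_one)
    qed
    ultimately show ?thesis using finL by (simp add: orbits_def card_image)
  qed
  have "card (coset_image G M X) = (\<Sum>C\<in>coset_image G L X. card (coset_image G M C))"
    unfolding UN
  proof (rule card_UN_disjoint[OF finX])
    show "\<forall>i\<in>coset_image G L X. finite (coset_image G M i)" using each by blast
    show "\<forall>i\<in>coset_image G L X. \<forall>j\<in>coset_image G L X. i \<noteq> j \<longrightarrow> coset_image G M i \<inter> coset_image G M j = {}"
    proof (intro ballI impI)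
      fix C D assume C: "C \<in> coset_image G L X" and D: "D \<in> coset_image G L X" and ne: "C \<noteq> D"
      show "coset_image G M C \<inter> coset_image G M D = {}"
      proof (rule ccontr)
        assume "coset_image G M C \<inter> coset_image G M D \<noteq> {}"
        then obtain x y where xy: "x \<in> C" "y \<in> D" "M #> x = M #> y" by (auto simp: coset_image_def)
        have xyG: "x \<in> carrier G" "y \<in> carrier G" using xy sub[OF C] sub[OF D] X(1) by auto
        obtain a b where ab: "a \<in> X" "C = L #> a" "b \<in> X" "D = L #> b" using C D by (auto simp: coset_image_def)
        have "x \<in> M #> y" using rcos_self[OF xyG(1) M(1)] xy(3) by simp
        then have "x \<in> L #> y" using M(2) by (auto simp: r_coset_def)
        then have "L #> y = L #> x" using repr_independence[OF _ _ L] xyG by metis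
        moreover have "L #> a = L #> x" using repr_independence[OF _ _ L, of x a] xy(1) ab X(1) by auto
        moreover have "L #> b = L #> y" using repr_independence[OF _ _ L, of y b] xy(2) ab X(1) by auto
        ultimately show False using ne ab by simp
      qed
    qed
  qed
  also have "\<dots> = (\<Sum>C\<in>coset_image G L X. orbits M L)" using each by (intro sum.cong) auto
  finally show ?thesis by (simp add: orbits_def)
qed

text \<open>
  Comparing numbers of orbits does not depend on which of several commensurable groups is used.
\<close>
lemma orbits_le_iff:
  assumes L: "subgroup L G" and M: "subgroup M G" "M \<subseteq> L" "near L M"
    and X: "X \<subseteq> carrier G" "\<And>l x. \<lbrakk>l \<in> L; x \<in> X\<rbrakk> \<Longrightarrow> l \<otimes> x \<in> X" "near X L"
    and Y: "Y \<subseteq> carrier G" "\<And>l x. \<lbrakk>l \<in> L; x \<in> Y\<rbrakk> \<Longrightarrow> l \<otimes> x \<in> Y" "near Y L"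
  shows "orbits L X \<le> orbits L Y \<longleftrightarrow> orbits M X \<le> orbits M Y"
proof -
  have LG: "L \<subseteq> carrier G" using L subgroup.subset by blast
  have "coset_image G M L \<noteq> {}" using subgroup.one_closed[OF L] by (auto simp: coset_image_def)
  then have "orbits M L > 0"
    unfolding orbits_def using finite_coset_image_iff[OF M(1) LG] M(3) by (simp add: card_gt_0_iff)
  then show ?thesis by (simp add: orbits_index[OF L M X] orbits_index[OF L M Y])
qed

section \<open>A preorder on almost invariant sets\<close>

text \<open>
  Inclusion up to a small error is a preorder, but it identifies equivalent sets, and that is too
  coarse: when \<open>G\<close> is infinite cyclic all translates of a half line are equivalent.  Equivalent sets
  are therefore compared further by the sizes of the two differences, measured in orbits of the
  intersection of their groups.  This is invariant under \<open>G\<close>, refines strict inclusion and leaves any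
  two equivalent sets comparable.
\<close>
fun ai_le :: "'a set \<times> 'a set \<Rightarrow> 'a set \<times> 'a set \<Rightarrow> bool" where
  "ai_le (S, U) (T, V) \<longleftrightarrow> near (U - V) S \<and>
     (near (V - U) S \<longrightarrow> orbits (S \<inter> T) (U - V) \<le> orbits (S \<inter> T) (V - U))"

declare ai_le.simps [simp del]

lemma ai_le_refl: "ai_le (S, U) (S, U)"
  by (auto simp: ai_le.simps near_def)

lemma ai_le_complement:
  assumes U: "essential S U" and V: "essential T V" and le: "ai_le (S, U) (T, V)"
  shows "ai_le (T, carrier G - V) (S, carrier G - U)"
proof -
  have "(carrier G - V) - (carrier G - U) = U - V" "(carrier G - U) - (carrier G - V) = V - U"
    using essentialD(2)[OF U] essentialD(2)[OF V] by auto
  then show ?thesis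
    using le small_diff_sym[OF U V] small_diff_sym[OF V U] by (simp add: ai_le.simps Int_commute)
qed

lemma not_ai_le_complement:
  assumes U: "essential S U" shows "\<not> ai_le (S, U) (S, carrier G - U)"
proof -
  have "U - (carrier G - U) = U" using essentialD(2)[OF U] by auto
  then show ?thesis using essentialD(5)[OF U] by (simp add: ai_le.simps)
qed

text \<open>
  If \<open>V - U\<close> is small as well, two natural numbers are compared; otherwise the first set is the
  smaller one.  So every pair with a small corner becomes comparable after complementing suitably.
\<close>
lemma ai_le_linear:
  assumes U: "essential S U" and V: "essential T V" and small: "near (U - V) S"
  shows "ai_le (S, U) (T, V) \<or> ai_le (T, V) (S, U)"
  using small small_diff_sym[OF U V] small_diff_sym[OF V U] by (auto simp: ai_le.simps Int_commute)

lemma orbits_eq_card_diff: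
  assumes "subgroup M G" "U \<subseteq> carrier G" "V \<subseteq> carrier G" "\<And>m v. \<lbrakk>m \<in> M; v \<in> V\<rbrakk> \<Longrightarrow> m \<otimes> v \<in> V"
  shows "orbits M (U - V) = card (coset_image G M U - coset_image G M V)"
  using coset_image_Diff[OF assms] by (simp add: orbits_def)

lemma orbits_le_iff_card:
  assumes U: "essential S U" and V: "essential T V" and M: "subgroup M G" "M \<subseteq> S \<inter> T" "near (S \<inter> T) M"
    and UV: "near (U - V) S" "near (V - U) S"
  shows "orbits (S \<inter> T) (U - V) \<le> orbits (S \<inter> T) (V - U) \<longleftrightarrow>
    card (coset_image G M U - coset_image G M V) \<le> card (coset_image G M V - coset_image G M U)"
    and "finite (coset_image G M U - coset_image G M V)"
proof -
  note DU = essentialD[OF U] and DV = essentialD[OF V]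
  note CU = essentialD[OF essential_complement[OF U]] and CV = essentialD[OF essential_complement[OF V]]
  have L: "subgroup (S \<inter> T) G" using DU(1) DV(1) subgroups_Inter_pair by blast
  have nUV: "near (U - V) (S \<inter> T)" using near_Int[OF DU(1) DV(1)] UV small_diff_sym[OF U V] by blast
  have nVU: "near (V - U) (S \<inter> T)" using near_Int[OF DU(1) DV(1)] UV small_diff_sym[OF V U] by blast
  have invU: "m \<otimes> u \<in> U" if "m \<in> M" "u \<in> U" for m u using that DU(3) M(2) by blast
  have invV: "m \<otimes> u \<in> V" if "m \<in> M" "u \<in> V" for m u using that DV(3) M(2) by blast
  have "orbits (S \<inter> T) (U - V) \<le> orbits (S \<inter> T) (V - U) \<longleftrightarrow> orbits M (U - V) \<le> orbits M (V - U)"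
  proof (rule orbits_le_iff[OF L M])
    fix l x assume l: "l \<in> S \<inter> T"
    show "l \<otimes> x \<in> U - V" if "x \<in> U - V" using DU(3)[of l x] CV(3)[of l x] l that DU(2) by auto
    show "l \<otimes> x \<in> V - U" if "x \<in> V - U" using DV(3)[of l x] CU(3)[of l x] l that DV(2) by auto
  qed (use DU(2) DV(2) nUV nVU in auto)
  then show "orbits (S \<inter> T) (U - V) \<le> orbits (S \<inter> T) (V - U) \<longleftrightarrow>
    card (coset_image G M U - coset_image G M V) \<le> card (coset_image G M V - coset_image G M U)"
    using orbits_eq_card_diff[OF M(1) DU(2) DV(2) invV] orbits_eq_card_diff[OF M(1) DV(2) DU(2) invU] by simp
  have "near (U - V) M" by (rule near_trans[OF nUV M(3)])
  moreover have "U - V \<subseteq> carrier G" using DU(2) by auto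
  ultimately have "finite (coset_image G M (U - V))" using finite_coset_image_iff[OF M(1)] by blast
  then show "finite (coset_image G M U - coset_image G M V)"
    using coset_image_Diff[OF M(1) DU(2) DV(2) invV] by simp
qed

text \<open>
  The only delicate case is that all three sets are equivalent.  Then their groups are commensurable,
  the three comparisons can be made with the common subgroup \<open>M\<close>, and they add up by
  \<open>card_diff_cocycle\<close>.
\<close>
lemma ai_le_trans:
  assumes U: "essential S U" and V: "essential T V" and W: "essential R W"
    and UV: "ai_le (S, U) (T, V)" and VW: "ai_le (T, V) (R, W)"
  shows "ai_le (S, U) (R, W)"
proof -
  have uv: "near (U - V) S" and vw: "near (V - W) T" using UV VW by (simp_all add: ai_le.simps)
  have uw: "near (U - W) S" by (rule small_diff_trans[OF U V W uv vw])
  moreover have "orbits (S \<inter> R) (U - W) \<le> orbits (S \<inter> R) (W - U)" if wu: "near (W - U) S"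
  proof -
    have wu': "near (W - U) R" using wu small_diff_sym[OF W U] by simp
    have vu: "near (V - U) T" by (rule small_diff_trans[OF V W U vw wu'])
    have wv: "near (W - V) R" by (rule small_diff_trans[OF W U V wu' uv])
    have vu': "near (V - U) S" using vu small_diff_sym[OF V U] by simp
    have wv': "near (W - V) T" using wv small_diff_sym[OF W V] by simp
    have uv': "near (U - V) T" using uv small_diff_sym[OF U V] by simp
    have uw': "near (U - W) R" using uw small_diff_sym[OF U W] by simp
    note grp = essentialD(1)[OF U] essentialD(1)[OF V] essentialD(1)[OF W]
    define M where "M = S \<inter> T \<inter> R"
    have M: "subgroup M G" using grp subgroups_Inter_pair unfolding M_def by blast
    have nearM: "near X M" if "near X S" "near X T" "near X R" for X
      using near_Int[OF subgroups_Inter_pair[OF grp(1,2)] grp(3)] near_Int[OF grp(1,2)] that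
      unfolding M_def by blast
    have ST: "near S T" by (rule commensurable_if_equivalent[OF U V uv' vu])
    have SR: "near S R" by (rule commensurable_if_equivalent[OF U W uw' wu'])
    have TR: "near T R" by (rule commensurable_if_equivalent[OF V W _ wv]) (use vw small_diff_sym[OF V W] in simp)
    have SS: "near S S" and TT: "near T T"
      using near_refl subgroup.subset grp by blast+
    have sub_near: "near X S" "near X T" "near X R" if "X \<subseteq> S" for X

      using near_mono[OF SS that subset_refl] near_mono[OF ST that subset_refl] near_mono[OF SR that subset_refl]
      by simp_all
    have "near (T \<inter> R) S"
      by (rule near_mono[OF commensurable_if_equivalent[OF V U vu' uv] _ subset_refl]) simp
    moreover have "near (T \<inter> R) T" "near (T \<inter> R) R" 
      by (rule near_mono[OF TT _ subset_refl], simp) (rule near_mono[OF TR _ subset_refl], simp)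
    ultimately have 1: "near (S \<inter> T) M" "near (S \<inter> R) M" "near (T \<inter> R) M"
      using nearM sub_near by (meson Int_lower1)+
    have sub: "M \<subseteq> S \<inter> T" "M \<subseteq> S \<inter> R" "M \<subseteq> T \<inter> R" "M \<subseteq> T \<inter> S" by (auto simp: M_def)
    let ?c = "coset_image G M"
    have a: "card (?c U - ?c V) \<le> card (?c V - ?c U)"
      using UV vu' orbits_le_iff_card(1)[OF U V M sub(1) 1(1) uv vu'] by (simp add: ai_le.simps)
    have b: "card (?c V - ?c W) \<le> card (?c W - ?c V)"
      using VW wv' orbits_le_iff_card(1)[OF V W M sub(3) 1(3) vw wv'] by (simp add: ai_le.simps)
    have "card (?c U - ?c V) + card (?c V - ?c W) + card (?c W - ?c U) =
        card (?c V - ?c U) + card (?c W - ?c V) + card (?c U - ?c W)"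
    proof (rule card_diff_cocycle)
      show "finite (?c U - ?c V)" by (rule orbits_le_iff_card(2)[OF U V M sub(1) 1(1) uv vu'])
      show "finite (?c V - ?c U)"
        by (rule orbits_le_iff_card(2)[OF V U M _ _ vu uv']) (use sub 1 in \<open>auto simp: Int_commute\<close>)
      show "finite (?c V - ?c W)" by (rule orbits_le_iff_card(2)[OF V W M sub(3) 1(3) vw wv'])
      show "finite (?c W - ?c V)"
        by (rule orbits_le_iff_card(2)[OF W V M _ _ wv])
          (use sub 1 vw small_diff_sym[OF V W] in \<open>auto simp: Int_commute\<close>)
    qed
    then have "card (?c U - ?c W) \<le> card (?c W - ?c U)" using a b by linarith
    then show ?thesis using orbits_le_iff_card(1)[OF U W M sub(2) 1(2) uw wu] by simp
  qed
  ultimately show ?thesis by (simp add: ai_le.simps)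
qed

text \<open>
  The two sets are then equivalent, one difference is empty and the other one is not.
\<close>
lemma not_ai_le_psubset:
  assumes U: "essential S U" and V: "essential T V" and VU: "V \<subset> U"
  shows "\<not> ai_le (S, U) (T, V)"
proof
  assume le: "ai_le (S, U) (T, V)"
  note grp = essentialD(1)[OF U] essentialD(1)[OF V]
  have ST: "subgroup (S \<inter> T) G" using grp subgroups_Inter_pair by blast
  have s: "near (U - V) S" using le by (simp add: ai_le.simps)
  then have "near (U - V) (S \<inter> T)" using near_Int[OF grp] small_diff_sym[OF U V] by blast
  then have fin: "finite (coset_image G (S \<inter> T) (U - V))"
    using finite_coset_image_iff[OF ST, of "U - V"] essentialD(2)[OF U] by blast
  have e: "V - U = {}" using VU by auto
  then have "orbits (S \<inter> T) (U - V) \<le> orbits (S \<inter> T) {}"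
    using le near_mono[OF s, of "V - U" S] by (simp add: ai_le.simps e)
  then have "coset_image G (S \<inter> T) (U - V) = {}" using fin by (simp add: orbits_def coset_image_def)
  then show False using VU by (auto simp: coset_image_def)
qed

section \<open>Translation\<close>

lemma mem_l_coset_iff:
  assumes "g \<in> carrier G" "X \<subseteq> carrier G"
  shows "x \<in> g <# X \<longleftrightarrow> x \<in> carrier G \<and> inv g \<otimes> x \<in> X"
proof
  assume "x \<in> g <# X"
  then show "x \<in> carrier G \<and> inv g \<otimes> x \<in> X" using assms by (auto simp: l_coset_def m_assoc[symmetric] subset_iff)
next
  assume x: "x \<in> carrier G \<and> inv g \<otimes> x \<in> X"
  then have "x = g \<otimes> (inv g \<otimes> x)" using assms by (simp add: m_assoc[symmetric])
  then show "x \<in> g <# X" using x by (auto simp: l_coset_def)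
qed

lemma mem_r_coset_iff:
  assumes "g \<in> carrier G" "X \<subseteq> carrier G"
  shows "x \<in> X #> g \<longleftrightarrow> x \<in> carrier G \<and> x \<otimes> inv g \<in> X"
proof
  assume "x \<in> X #> g"
  then show "x \<in> carrier G \<and> x \<otimes> inv g \<in> X" using assms by (auto simp: r_coset_def m_assoc subset_iff)
next
  assume x: "x \<in> carrier G \<and> x \<otimes> inv g \<in> X"
  then have "x = (x \<otimes> inv g) \<otimes> g" using assms by (simp add: m_assoc)
  then show "x \<in> X #> g" using x by (auto simp: r_coset_def)
qed

abbreviation conjugate :: "'a \<Rightarrow> 'a set \<Rightarrow> 'a set" where
  "conjugate g S \<equiv> g <# S #> inv g"

lemma mem_conjugate_iff:
  assumes "g \<in> carrier G" "S \<subseteq> carrier G"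
  shows "x \<in> conjugate g S \<longleftrightarrow> x \<in> carrier G \<and> inv g \<otimes> x \<otimes> g \<in> S"
  using assms mem_r_coset_iff[of "inv g" "g <# S" x] mem_l_coset_iff[of g S "x \<otimes> g"]
  by (auto simp: l_coset_subset_G m_assoc)

lemma conjugate_subset: "\<lbrakk>g \<in> carrier G; S \<subseteq> carrier G\<rbrakk> \<Longrightarrow> conjugate g S \<subseteq> carrier G"
  by (simp add: l_coset_subset_G r_coset_subset_G)

lemma conjugate_Int:
  assumes "g \<in> carrier G" "S \<subseteq> carrier G" "T \<subseteq> carrier G"
  shows "conjugate g S \<inter> conjugate g T = conjugate g (S \<inter> T)"
proof -
  have "S \<inter> T \<subseteq> carrier G" using assms by auto
  then have "x \<in> conjugate g S \<inter> conjugate g T \<longleftrightarrow> x \<in> conjugate g (S \<inter> T)" for x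
    using mem_conjugate_iff[OF assms(1,2), of x] mem_conjugate_iff[OF assms(1,3), of x] mem_conjugate_iff[OF assms(1), of "S \<inter> T" x]
    by auto
  then show ?thesis by blast
qed

lemma l_coset_Diff:
  assumes "g \<in> carrier G" "U \<subseteq> carrier G" "V \<subseteq> carrier G"
  shows "g <# (U - V) = (g <# U) - (g <# V)"
proof -
  have "U - V \<subseteq> carrier G" using assms by auto
  then have "x \<in> g <# (U - V) \<longleftrightarrow> x \<in> (g <# U) - (g <# V)" for x
    using mem_l_coset_iff[OF assms(1,2), of x] mem_l_coset_iff[OF assms(1,3), of x]
      mem_l_coset_iff[OF assms(1), of "U - V" x]
    by auto
  then show ?thesis by blast
qed

lemma l_coset_carrier_eq: "g \<in> carrier G \<Longrightarrow> g <# carrier G = carrier G"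
  using mem_l_coset_iff[of g "carrier G"] by auto

lemma l_coset_complement:
  "\<lbrakk>g \<in> carrier G; U \<subseteq> carrier G\<rbrakk> \<Longrightarrow> g <# (carrier G - U) = carrier G - (g <# U)"
  by (simp add: l_coset_Diff l_coset_carrier_eq)

lemma conjugate_conjugate:
  assumes "g \<in> carrier G" "k \<in> carrier G" "S \<subseteq> carrier G"
  shows "conjugate g (conjugate k S) = conjugate (g \<otimes> k) S"
proof -
  have "x \<in> conjugate g (conjugate k S) \<longleftrightarrow> x \<in> conjugate (g \<otimes> k) S" for x
    using assms mem_conjugate_iff[OF assms(1) conjugate_subset[OF assms(2,3)], of x]
      mem_conjugate_iff[OF assms(2,3), of "inv g \<otimes> x \<otimes> g"] mem_conjugate_iff[of "g \<otimes> k" S x]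
    by (auto simp: inv_mult_group m_assoc)
  then show ?thesis by blast
qed

lemma conjugate_one: "S \<subseteq> carrier G \<Longrightarrow> conjugate \<one> S = S"
  using mem_conjugate_iff[of \<one> S] by (auto simp: subset_iff)

lemma subgroup_conjugate:
  assumes "g \<in> carrier G" "subgroup S G" shows "subgroup (conjugate g S) G"
proof -
  have SG: "S \<subseteq> carrier G" using assms subgroup.subset by blast
  note m = mem_conjugate_iff[OF assms(1) SG]
  show ?thesis
  proof (rule subgroup.intro)
    show "conjugate g S \<subseteq> carrier G" using conjugate_subset assms SG by blast
    show "\<one> \<in> conjugate g S" using assms subgroup.one_closed by (simp add: m)
    fix x assume x: "x \<in> conjugate g S"
    have "inv (inv g \<otimes> x \<otimes> g) \<in> S" using x subgroup.m_inv_closed[OF assms(2)] by (simp add: m)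
    then show "inv x \<in> conjugate g S" using x assms(1) by (simp add: m inv_mult_group m_assoc)
    fix y assume y: "y \<in> conjugate g S"
    have "(inv g \<otimes> x \<otimes> g) \<otimes> (inv g \<otimes> y \<otimes> g) \<in> S"
      using x y subgroup.m_closed[OF assms(2)] by (simp add: m)
    moreover have "(inv g \<otimes> x \<otimes> g) \<otimes> (inv g \<otimes> y \<otimes> g) = inv g \<otimes> (x \<otimes> y) \<otimes> g"
    proof -
      have "g \<otimes> (inv g \<otimes> (y \<otimes> g)) = y \<otimes> g" using x y assms(1) by (simp add: m m_assoc[symmetric])
      then show ?thesis using x y assms(1) by (simp add: m m_assoc)
    qed
    ultimately show "x \<otimes> y \<in> conjugate g S" using x y by (simp add: m)
  qed
qed

lemma near_translate:
  assumes g: "g \<in> carrier G" and S: "S \<subseteq> carrier G" and near: "near X S"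
  shows "near (g <# X) (conjugate g S)"
proof -
  obtain F where F: "X \<subseteq> carrier G" "finite F" "F \<subseteq> carrier G" "\<And>p. p \<in> X \<Longrightarrow> \<exists>f\<in>F. p \<otimes> f \<in> S"
    using nearE[OF near] by metis
  show ?thesis
  proof (rule nearI[of _ "(\<lambda>f. f \<otimes> inv g) ` F"])
    fix p assume "p \<in> g <# X"
    then obtain x where x: "x \<in> X" "p = g \<otimes> x" by (auto simp: l_coset_def)
    obtain f where f: "f \<in> F" "x \<otimes> f \<in> S" using F(4) x by blast
    have "p \<otimes> (f \<otimes> inv g) = g \<otimes> (x \<otimes> f) \<otimes> inv g" using x f F g by (simp add: m_assoc subset_iff)
    then have "p \<otimes> (f \<otimes> inv g) \<in> conjugate g S" using f by (auto simp: l_coset_def r_coset_def)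
    then show "\<exists>f\<in>(\<lambda>f. f \<otimes> inv g) ` F. p \<otimes> f \<in> conjugate g S" using f by blast
  qed (use F g l_coset_subset_G in auto)
qed

lemma near_translate_iff:
  assumes g: "g \<in> carrier G" and S: "S \<subseteq> carrier G" and X: "X \<subseteq> carrier G"
  shows "near (g <# X) (conjugate g S) \<longleftrightarrow> near X S"
proof
  assume "near (g <# X) (conjugate g S)"
  then have "near (inv g <# (g <# X)) (conjugate (inv g) (conjugate g S))"
    using near_translate g S conjugate_subset by blast
  moreover have "inv g <# (g <# X) = X" using g X by (simp add: lcos_m_assoc lcos_mult_one)
  moreover have "conjugate (inv g) (conjugate g S) = S" using conjugate_conjugate[of "inv g" g S] conjugate_one[OF S] g S by simp
  ultimately show "near X S" by simp
qed (rule near_translate[OF g S])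

lemma orbits_translate:
  assumes g: "g \<in> carrier G" and L: "L \<subseteq> carrier G" and X: "X \<subseteq> carrier G"
  shows "orbits (conjugate g L) (g <# X) = orbits L X"
proof -
  have step: "conjugate g L #> (g \<otimes> x) = g <# (L #> x)" if x: "x \<in> carrier G" for x
  proof -
    have "conjugate g L #> (g \<otimes> x) = (g <# L) #> (inv g \<otimes> (g \<otimes> x))"
      using g x L by (simp add: coset_mult_assoc l_coset_subset_G)
    also have "inv g \<otimes> (g \<otimes> x) = x" using g x by (simp add: m_assoc[symmetric])
    also have "(g <# L) #> x = g <# (L #> x)" using g x L by (simp add: rcos_assoc_lcos coset_assoc)
    finally show ?thesis .
  qed
  have "coset_image G (conjugate g L) (g <# X) = (\<lambda>C. g <# C) ` coset_image G L X"
  proof -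
    have "g <# X = (\<lambda>x. g \<otimes> x) ` X" by (auto simp: l_coset_def)
    then show ?thesis using step X by (auto simp: coset_image_def image_image subset_iff intro!: image_cong)
  qed
  moreover have "inj_on (\<lambda>C. g <# C) (coset_image G L X)"
  proof (rule inj_on_inverseI)
    fix C assume "C \<in> coset_image G L X"
    then have "C \<subseteq> carrier G" using r_coset_subset_G[OF L] X by (auto simp: coset_image_def)
    then show "inv g <# (g <# C) = C" using g by (simp add: lcos_m_assoc lcos_mult_one)
  qed
  ultimately show ?thesis by (simp add: orbits_def card_image)
qed

lemma essential_translate:
  assumes g: "g \<in> carrier G" and U: "essential H U"
  shows "essential (conjugate g H) (g <# U)"
proof -
  note D = essentialD[OF U]
  have "{p \<in> g <# U. p \<otimes> k \<notin> g <# U} = g <# {p \<in> U. p \<otimes> k \<notin> U}" if k: "k \<in> carrier G" for k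
  proof -
    have s: "{p \<in> U. p \<otimes> k \<notin> U} \<subseteq> carrier G" using D by auto
    have "p \<in> {p \<in> g <# U. p \<otimes> k \<notin> g <# U} \<longleftrightarrow> p \<in> g <# {p \<in> U. p \<otimes> k \<notin> U}" for p
      using g k by (auto simp: mem_l_coset_iff[OF g D(2)] mem_l_coset_iff[OF g s] m_assoc)
    then show ?thesis by blast
  qed
  moreover have "h \<otimes> u \<in> g <# U" if h: "h \<in> conjugate g H" and u: "u \<in> g <# U" for h u
  proof -
    have hu: "h \<in> carrier G" "u \<in> carrier G" "inv g \<otimes> h \<otimes> g \<in> H" "inv g \<otimes> u \<in> U"
      using h u mem_conjugate_iff[OF g D(7)] mem_l_coset_iff[OF g D(2)] by auto
    have "(inv g \<otimes> h \<otimes> g) \<otimes> (inv g \<otimes> u) = inv g \<otimes> (h \<otimes> u)"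
    proof -
      have "g \<otimes> (inv g \<otimes> u) = u" using hu g by (simp add: m_assoc[symmetric])
      then show ?thesis using hu g by (simp add: m_assoc)
    qed
    then show ?thesis using D(3)[OF hu(3,4)] hu mem_l_coset_iff[OF g D(2)] by simp
  qed
  moreover have "near {p \<in> U. p \<otimes> k \<notin> U} H" "{p \<in> U. p \<otimes> k \<notin> U} \<subseteq> carrier G" if "k \<in> carrier G" for k
    using D that by auto
  moreover have "\<not> near (g <# U) (conjugate g H)" using near_translate_iff[OF g D(7,2)] D(5) by simp
  moreover have "\<not> near (carrier G - (g <# U)) (conjugate g H)"
    using near_translate_iff[OF g D(7), of "carrier G - U"] D(6) l_coset_complement[OF g D(2)] by simp
  ultimately show ?thesis
    using subgroup_conjugate[OF g D(1)] l_coset_subset_G[OF D(2) g] near_translate[OF g D(7)]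
    unfolding essential_def by simp
qed

lemma ai_le_translate_iff:
  assumes g: "g \<in> carrier G" and U: "essential S U" and V: "essential T V"
  shows "ai_le (conjugate g S, g <# U) (conjugate g T, g <# V) \<longleftrightarrow> ai_le (S, U) (T, V)"
proof -
  note DU = essentialD[OF U] and DV = essentialD[OF V]
  have s: "U - V \<subseteq> carrier G" "V - U \<subseteq> carrier G" "S \<inter> T \<subseteq> carrier G" using DU DV by auto
  show ?thesis
    by (simp add: ai_le.simps l_coset_Diff[OF g DU(2) DV(2), symmetric] l_coset_Diff[OF g DV(2) DU(2), symmetric]
        conjugate_Int[OF g DU(7) DV(7)] near_translate_iff[OF g DU(7) s(1)] near_translate_iff[OF g DU(7) s(2)]
        orbits_translate[OF g s(3,1)] orbits_translate[OF g s(3,2)])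
qed

section \<open>Which translates are not nested\<close>

text \<open>
  Connectedness of the Cayley graph: a set \<open>V\<close> that no single step from \<open>Q\<close> enters or leaves contains
  all or nothing of what can be reached in \<open>Q\<close>.
\<close>
lemma generate_side_constant:
  assumes T: "T \<subseteq> carrier G" and Q: "Q \<subseteq> carrier G"
    "\<And>q w. \<lbrakk>q \<in> Q; w \<in> generate G T\<rbrakk> \<Longrightarrow> q \<otimes> w \<in> Q"
    and step: "\<And>q t. \<lbrakk>q \<in> Q; t \<in> T\<rbrakk> \<Longrightarrow> (q \<otimes> t \<in> V) = (q \<in> V)"
    and w: "w \<in> generate G T" and q: "q \<in> Q"
  shows "(q \<otimes> w \<in> V) = (q \<in> V)"
  using w q
proof (induction w arbitrary: q)
  case one
  then show ?case using Q(1) by (simp add: subset_iff)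
next
  case (incl t)
  then show ?case using step by simp
next
  case (inv t)
  have "q \<otimes> inv t \<in> Q" using Q(2)[OF inv.prems generate.inv[OF inv.hyps]] .
  moreover have "q \<otimes> inv t \<otimes> t = q" using inv T Q(1) by (simp add: m_assoc subset_iff)
  ultimately show ?case using step inv.hyps by metis
next
  case (eng w1 w2)
  have "q \<otimes> w1 \<in> Q" using Q(2)[OF eng.prems eng.hyps(1)] .
  moreover have "q \<otimes> (w1 \<otimes> w2) = q \<otimes> w1 \<otimes> w2"
    using eng.prems eng.hyps Q(1) generate_in_carrier[OF T] by (simp add: m_assoc subset_iff)
  ultimately show ?case using eng.IH eng.prems by simp
qed

text \<open>
  The boundary of \<open>U\<close> in the Cayley graph, with the elements of \<open>F\<close> as steps.
\<close>
definition frontier :: "'a set \<Rightarrow> 'a set \<Rightarrow> 'a set" where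
  "frontier F U = {p \<in> carrier G. \<exists>f\<in>F. (p \<otimes> f \<in> U) \<noteq> (p \<in> U)}"

lemma near_frontier:
  assumes U: "essential H U" and F: "finite F" "F \<subseteq> carrier G"
  shows "near (frontier F U) H"
proof -
  have "near ({p \<in> U. p \<otimes> f \<notin> U} \<union> {p \<in> carrier G - U. p \<otimes> f \<notin> carrier G - U}) H" if "f \<in> F" for f
    using near_Un essentialD(4)[OF U] essentialD(4)[OF essential_complement[OF U]] that F(2) by blast
  then have "near (\<Union>f\<in>F. {p \<in> U. p \<otimes> f \<notin> U} \<union> {p \<in> carrier G - U. p \<otimes> f \<notin> carrier G - U}) H"
    by (rule near_UN[OF F(1)])
  then show ?thesis
    by (rule near_mono[OF _ _ subset_refl]) (use F(2) in \<open>auto simp: frontier_def\<close>)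
qed

lemma frontier_l_coset_iff:
  assumes "g \<in> carrier G" "F \<subseteq> carrier G" "V \<subseteq> carrier G" "p \<in> carrier G"
  shows "p \<in> frontier F (g <# V) \<longleftrightarrow> inv g \<otimes> p \<in> frontier F V"
proof -
  have "(p \<otimes> f \<in> g <# V) = (inv g \<otimes> p \<otimes> f \<in> V)" if "f \<in> F" for f
    using that assms by (auto simp: mem_l_coset_iff m_assoc subset_iff)
  then show ?thesis using assms by (auto simp: frontier_def mem_l_coset_iff)
qed

text \<open>
  If each boundary lies on one side of the other set, then the opposite corner \<open>M\<close> contains no boundary
  point of either set, so it is closed under multiplication by generators.  The Cayley graph is
  connected and \<open>M\<close> misses \<open>P\<close>, hence \<open>M\<close> is empty.
\<close>
lemma nested_if_frontiers_separated:
  assumes C: "C \<subseteq> carrier G" "generate G C = carrier G" "\<And>c. c \<in> C \<Longrightarrow> inv c \<in> C"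
    and U: "U \<subseteq> carrier G" and V: "V \<subseteq> carrier G"
    and P: "frontier C U \<subseteq> P" "P \<subseteq> carrier G" "P \<noteq> {}" "\<And>p. p \<in> P \<Longrightarrow> (p \<in> V) = b"
    and Q: "frontier C V \<subseteq> Q" "\<And>q. q \<in> Q \<Longrightarrow> (q \<in> U) = a"
  shows "nested G U V"
proof -
  define M where "M = {x \<in> carrier G. (x \<in> U) \<noteq> a \<and> (x \<in> V) \<noteq> b}"
  have closed: "x \<otimes> c \<in> M" if x: "x \<in> M" and c: "c \<in> C" for x c
  proof -
    have xG: "x \<in> carrier G" "x \<notin> P" "x \<notin> Q" using x P(4) Q(2) by (auto simp: M_def)
    then have "(x \<otimes> c \<in> U) = (x \<in> U)" "(x \<otimes> c \<in> V) = (x \<in> V)"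
      using P(1) Q(1) c by (auto simp: frontier_def)
    then show ?thesis using x c C(1) by (auto simp: M_def)
  qed
  have const: "(q \<otimes> w \<in> M) = (q \<in> M)" if "q \<in> carrier G" "w \<in> carrier G" for q w
  proof (rule generate_side_constant[OF C(1) subset_refl])
    fix q c assume q: "q \<in> carrier G" and c: "c \<in> C"
    have "q \<otimes> c \<otimes> inv c = q" using q c C(1) by (simp add: m_assoc subset_iff)
    then show "(q \<otimes> c \<in> M) = (q \<in> M)" using closed[of q c] closed[of "q \<otimes> c" "inv c"] C(3) c by metis
  qed (use that C(2) in auto)
  obtain p where p: "p \<in> P" using P(3) by blast
  have "M = {}"
  proof (rule ccontr)
    assume "M \<noteq> {}"
    then obtain m where m: "m \<in> M" by blast
    have G: "m \<in> carrier G" "p \<in> carrier G" using m p P(2) by (auto simp: M_def)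
    then have "m \<otimes> (inv m \<otimes> p) = p" by (simp add: m_assoc[symmetric])
    then have "p \<in> M" using const[of m "inv m \<otimes> p"] m G by simp
    then show False using P(4)[OF p] by (simp add: M_def)
  qed
  moreover have "M = (if a then carrier G - U else U) \<inter> (if b then carrier G - V else V)"
    using U V by (auto simp: M_def)
  moreover have "M \<in> corners G U V" unfolding calculation(2) corners_def by auto
  ultimately show ?thesis by (simp add: nested_def)
qed

lemma symmetric_generators:
  assumes "finitely_generated G (carrier G)"
  obtains C where "finite C" "C \<subseteq> carrier G" "generate G C = carrier G" "\<And>c. c \<in> C \<Longrightarrow> inv c \<in> C"
proof -
  obtain C where C: "finite C" "C \<subseteq> carrier G" "generate G C = carrier G"
    using assms unfolding finitely_generated_def by blast
  let ?C = "C \<union> m_inv G ` C"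
  have sub: "?C \<subseteq> carrier G" using C(2) by auto
  have "generate G ?C = carrier G"
    using mono_generate[of C ?C] generate_incl[OF sub] C(3) by auto
  moreover have "inv c \<in> ?C" if "c \<in> ?C" for c using that C(2) by (auto simp: subset_iff)
  ultimately show thesis using that[of ?C] C(1) sub by simp
qed

text \<open>
  As \<open>H\<close> is finitely generated, it is connected by steps of bounded length, and so is the union of \<open>H\<close>
  with the boundary of \<open>U\<close>, all of whose points are near \<open>H\<close>.  If \<open>H\<close> avoids the boundary of \<open>gV\<close> for
  steps of that length, this union lies on one side of \<open>gV\<close>.  The same holds for \<open>gK\<close> and \<open>U\<close>.  If both
  groups stay clear in this way, the pair is nested.  Otherwise a point of one coset is near the other
  coset, which leaves finitely many double cosets for \<open>g\<close>.
\<close>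
lemma nested_outside_finitely_many_double_cosets:
  assumes G: "finitely_generated G (carrier G)"
    and H: "finitely_generated G H" and K: "finitely_generated G K"
    and U: "essential H U" and V: "essential K V"
  obtains D where "finite D" "D \<subseteq> carrier G"
    "\<And>g. \<lbrakk>g \<in> carrier G; \<not> nested G U (g <# V)\<rbrakk> \<Longrightarrow> \<exists>h\<in>H. \<exists>d\<in>D. \<exists>k\<in>K. g = h \<otimes> d \<otimes> k"
proof -
  note DU = essentialD[OF U] and DV = essentialD[OF V]
  obtain C where C: "finite C" "C \<subseteq> carrier G" "generate G C = carrier G" "\<And>c. c \<in> C \<Longrightarrow> inv c \<in> C"
    using symmetric_generators[OF G] by metis
  obtain S where S: "finite S" "S \<subseteq> carrier G" "generate G S = H" using H unfolding finitely_generated_def by blast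
  obtain T where T: "finite T" "T \<subseteq> carrier G" "generate G T = K" using K unfolding finitely_generated_def by blast
  obtain A where A: "finite A" "A \<subseteq> carrier G" "\<And>p. p \<in> frontier C U \<Longrightarrow> \<exists>f\<in>A. p \<otimes> f \<in> H"
    using nearE[OF near_frontier[OF U C(1,2)]] by metis
  obtain B where B: "finite B" "B \<subseteq> carrier G" "\<And>p. p \<in> frontier C V \<Longrightarrow> \<exists>f\<in>B. p \<otimes> f \<in> K"
    using nearE[OF near_frontier[OF V C(1,2)]] by metis
  \<comment> \<open>Steps from \<open>F\<close> connect each group, by \<open>S\<close> and \<open>T\<close>, and also join it to the boundary points near it.\<close>
  define F where "F = S \<union> T \<union> m_inv G ` A \<union> m_inv G ` B"
  have F: "finite F" "F \<subseteq> carrier G" using S T A B by (auto simp: F_def)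
  obtain A' where A': "finite A'" "A' \<subseteq> carrier G" "\<And>p. p \<in> frontier F U \<Longrightarrow> \<exists>f\<in>A'. p \<otimes> f \<in> H"
    using nearE[OF near_frontier[OF U F]] by metis
  obtain B' where B': "finite B'" "B' \<subseteq> carrier G" "\<And>p. p \<in> frontier F V \<Longrightarrow> \<exists>f\<in>B'. p \<otimes> f \<in> K"
    using nearE[OF near_frontier[OF V F]] by metis
  \<comment> \<open>A coset \<open>yL\<close> that avoids the boundary of \<open>X\<close> lies, with all points \<open>q\<close> one step away, on the side of \<open>y\<close>.\<close>
  have one_side: "(q \<in> X) = (y \<in> X)"
    if y: "y \<in> carrier G" and L: "subgroup L G" "R \<subseteq> carrier G" "generate G R = L" "R \<subseteq> F" "m_inv G ` E \<subseteq> F" "E \<subseteq> carrier G"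
      and avoid: "\<And>l. l \<in> L \<Longrightarrow> y \<otimes> l \<notin> frontier F X"
      and q: "q \<in> carrier G" "e \<in> insert \<one> E" "inv y \<otimes> q \<otimes> e \<in> L" for y L R E X q e
  proof -
    have LG: "L \<subseteq> carrier G" using L(1) subgroup.subset by blast
    have stay: "(x \<otimes> f \<in> X) = (x \<in> X)" if "x \<in> y <# L" "f \<in> F" for x f
    proof -
      obtain l where l: "l \<in> L" "x = y \<otimes> l" using \<open>x \<in> y <# L\<close> by (auto simp: l_coset_def)
      then show ?thesis using avoid[OF l(1)] \<open>f \<in> F\<close> y LG by (auto simp: frontier_def)
    qed
    have yL: "y <# L \<subseteq> carrier G" using y LG l_coset_subset_G by blast
    let ?l = "inv y \<otimes> q \<otimes> e"
    have eG: "e \<in> carrier G" using q(2) L(6) by auto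
    have yl: "y \<otimes> ?l = q \<otimes> e" using y q(1) eG by (simp add: m_assoc[symmetric])
    have y1: "y \<in> y <# L" using subgroup.one_closed[OF L(1)] y by (force simp: l_coset_def)
    have "(y \<otimes> ?l \<in> X) = (y \<in> X)"
    proof (rule generate_side_constant[OF L(2) yL])
      fix x w assume "x \<in> y <# L" "w \<in> generate G R"
      then obtain l where l: "l \<in> L" "x = y \<otimes> l" "w \<in> L" using L(3) by (auto simp: l_coset_def)
      then have "x \<otimes> w = y \<otimes> (l \<otimes> w)" using y LG by (simp add: m_assoc subset_iff)
      then show "x \<otimes> w \<in> y <# L" using subgroup.m_closed[OF L(1) l(1,3)] by (auto simp: l_coset_def)
    next
      show "(x \<otimes> t \<in> X) = (x \<in> X)" if "x \<in> y <# L" "t \<in> R" for x t using stay that L(4) by blast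
    qed (use q(3) L(3) y1 in auto)
    moreover have "(q \<otimes> e \<in> X) = (q \<in> X)"
    proof (cases "e = \<one>")
      case False
      then have "inv e \<in> F" using q(2) L(5) by auto
      moreover have "q \<otimes> e \<in> y <# L" using yl q(3) by (metis (no_types, lifting) l_coset_def UN_iff singletonI)
      ultimately have "(q \<otimes> e \<otimes> inv e \<in> X) = (q \<otimes> e \<in> X)" by (rule stay[rotated])
      moreover have "q \<otimes> e \<otimes> inv e = q" using q(1) eG by (simp add: m_assoc)
      ultimately show ?thesis by simp
    qed (use q(1) in simp)
    ultimately show ?thesis using yl by simp
  qed
  show thesis
  proof (rule that[of "m_inv G ` A' \<union> B'"])
    fix g assume g: "g \<in> carrier G" and not_nested: "\<not> nested G U (g <# V)"
    have gV: "g <# V \<subseteq> carrier G" using g DV(2) l_coset_subset_G by blast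
    define P where "P = {p \<in> carrier G. \<exists>f\<in>insert \<one> A. p \<otimes> f \<in> H}"
    define Q where "Q = {q \<in> carrier G. \<exists>f\<in>insert \<one> B. inv g \<otimes> q \<otimes> f \<in> K}"
    have FP: "frontier C U \<subseteq> P" using A(3) by (auto simp: P_def frontier_def)
    have FQ: "frontier C (g <# V) \<subseteq> Q"
    proof
      fix q assume q: "q \<in> frontier C (g <# V)"
      then have qG: "q \<in> carrier G" by (simp add: frontier_def)
      then have "inv g \<otimes> q \<in> frontier C V" using frontier_l_coset_iff[OF g C(2) DV(2) qG] q by simp
      then show "q \<in> Q" using B(3) qG by (auto simp: Q_def)
    qed
    have "\<one> \<in> P" using subgroup.one_closed[OF DU(1)] by (simp add: P_def)
    \<comment> \<open>The sets \<open>P\<close> and \<open>Q\<close> are bounded thickenings of \<open>H\<close> and \<open>gK\<close> that contain the two boundaries.\<close>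
    have "\<not> ((\<forall>h\<in>H. h \<notin> frontier F (g <# V)) \<and> (\<forall>k\<in>K. g \<otimes> k \<notin> frontier F U))"
    proof
      assume *: "(\<forall>h\<in>H. h \<notin> frontier F (g <# V)) \<and> (\<forall>k\<in>K. g \<otimes> k \<notin> frontier F U)"
      have "(p \<in> g <# V) = (\<one> \<in> g <# V)" if "p \<in> P" for p
      proof -
        obtain f where f: "p \<in> carrier G" "f \<in> insert \<one> A" "p \<otimes> f \<in> H" using \<open>p \<in> P\<close> by (auto simp: P_def)
        show ?thesis
          by (rule one_side[OF one_closed DU(1) S(2,3) _ _ A(2) _ f(1,2)])
            (use * f DU(7) in \<open>auto simp: F_def subset_iff\<close>)
      qed
      moreover have "(q \<in> U) = (g \<in> U)" if "q \<in> Q" for q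
      proof -
        obtain f where f: "q \<in> carrier G" "f \<in> insert \<one> B" "inv g \<otimes> q \<otimes> f \<in> K" using \<open>q \<in> Q\<close> by (auto simp: Q_def)
        show ?thesis
          by (rule one_side[OF g DV(1) T(2,3) _ _ B(2) _ f]) (use * in \<open>auto simp: F_def\<close>)
      qed
      moreover have "P \<subseteq> carrier G" "P \<noteq> {}" using \<open>\<one> \<in> P\<close> by (auto simp: P_def)
      ultimately have "nested G U (g <# V)"
        using nested_if_frontiers_separated[OF C(2,3,4) DU(2) gV FP _ _ _ FQ, of "\<one> \<in> g <# V" "g \<in> U"] by simp
      then show False using not_nested by simp
    qed
    then consider h where "h \<in> H" "h \<in> frontier F (g <# V)" | k where "k \<in> K" "g \<otimes> k \<in> frontier F U" by blast
    then show "\<exists>h\<in>H. \<exists>d\<in>m_inv G ` A' \<union> B'. \<exists>k\<in>K. g = h \<otimes> d \<otimes> k"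
    proof cases
      case 1
      have hG: "h \<in> carrier G" using 1 DU by auto
      then obtain d where d: "d \<in> B'" "inv g \<otimes> h \<otimes> d \<in> K"
        using B'(3) frontier_l_coset_iff[OF g F(2) DV(2) hG] 1 by blast
      let ?k = "inv g \<otimes> h \<otimes> d"
      have dG: "d \<in> carrier G" using d B' by auto
      have "g = h \<otimes> d \<otimes> inv ?k"
      proof -
        have "g \<otimes> ?k = h \<otimes> d" using g hG dG by (simp add: m_assoc[symmetric])
        then show ?thesis using g hG dG by (metis inv_solve_right m_closed inv_closed)
      qed
      then show ?thesis using 1 d subgroup.m_inv_closed[OF DV(1)] by blast
    next
      case 2
      then obtain d where d: "d \<in> A'" "g \<otimes> k \<otimes> d \<in> H" using A'(3) by blast
      let ?h = "g \<otimes> k \<otimes> d"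
      have dG: "d \<in> carrier G" and kG: "k \<in> carrier G" using d A' 2 DV by auto
      have "?h \<otimes> inv d \<otimes> inv k = g" using g dG kG by (simp add: m_assoc)
      then show ?thesis using 2 d subgroup.m_inv_closed[OF DV(1)] by (metis UnI1 image_eqI)
    qed
  qed (use A' B' in auto)
qed

text \<open>
  Left translation by elements of \<open>H\<close> does not change the distance to \<open>H\<close>.
\<close>
lemma near_saturate:
  assumes H: "subgroup H G" and X: "near X H"
  shows "near {p \<in> carrier G. \<exists>h\<in>H. h \<otimes> p \<in> X} H"
proof -
  obtain F where F: "finite F" "F \<subseteq> carrier G" "\<And>p. p \<in> X \<Longrightarrow> \<exists>f\<in>F. p \<otimes> f \<in> H"
    using nearE[OF X] by metis
  show ?thesis
  proof (rule nearI[OF _ F(1,2)])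
    fix p assume "p \<in> {p \<in> carrier G. \<exists>h\<in>H. h \<otimes> p \<in> X}"
    then obtain h f where p: "p \<in> carrier G" "h \<in> H" "f \<in> F" "h \<otimes> p \<otimes> f \<in> H" using F(3) by blast
    have G: "h \<in> carrier G" "f \<in> carrier G" using p F(2) subgroup.mem_carrier[OF H] by auto
    have "inv h \<otimes> (h \<otimes> p \<otimes> f) \<in> H" using subgroup.m_closed[OF H] subgroup.m_inv_closed[OF H] p by blast
    moreover have "inv h \<otimes> (h \<otimes> p \<otimes> f) = p \<otimes> f" using p G by (simp add: m_assoc[symmetric])
    ultimately show "\<exists>f\<in>F. p \<otimes> f \<in> H" using p by metis
  qed auto
qed

text \<open>
  Two of the four nestings contradict nontriviality, and \<open>V \<subset> U\<close> contradicts the order between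
  equivalent sets.  So the order deviates from inclusion only for pairs that are not nested.
\<close>
lemma subset_if_nested_ai_le:
  assumes U: "essential S U" and V: "essential T V" and le: "ai_le (S, U) (T, V)" and nested: "nested G U V"
  shows "U \<subseteq> V"
proof -
  note DU = essentialD[OF U] and DV = essentialD[OF V]
  have s: "near (U - V) S" using le by (simp add: ai_le.simps)
  consider "U \<inter> V = {}" | "(carrier G - U) \<inter> V = {}" | "U \<inter> (carrier G - V) = {}"
    | "(carrier G - U) \<inter> (carrier G - V) = {}"
    using nested by (auto simp: nested_def corners_def)
  then show ?thesis
  proof cases
    case 1
    then have "U - V = U" by auto
    then show ?thesis using s DU(5) by simp
  next
    case 2
    then have "V \<subseteq> U" using DV(2) by auto
    then show ?thesis using not_ai_le_psubset[OF U V] le by blast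
  next
    case 3
    then show ?thesis using DU(2) by auto
  next
    case 4
    then have "U - V = carrier G - V" using DU(2) by auto
    then show ?thesis using s DV(6) small_diff_sym[OF U V] by simp
  qed
qed

lemma l_coset_stable:
  assumes "essential H U" "h \<in> H" shows "h <# U = U"
  using l_coset_subset_iff essentialD[OF assms(1)] assms(2) by blast

lemma conjugate_stable:
  assumes H: "subgroup H G" and h: "h \<in> H" shows "conjugate h H = H"
proof -
  have "h <# H = H" using lcos_mult_one l_coset_subset_iff[OF H subgroup.subset[OF H]] subgroup.m_closed[OF H] h by blast
  then show ?thesis using coset_join2[OF _ H] subgroup.m_inv_closed[OF H h] subgroup.mem_carrier[OF H] h by simp
qed

text \<open>
  Only non-nested translates contribute, and these come from finitely many double cosets \<open>HdK\<close>.  Since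
  \<open>hU = U\<close> and \<open>kV = V\<close>, the translates in \<open>HdK\<close> contribute the left \<open>H\<close>-translates of the single small
  set \<open>U - dV\<close>.
\<close>
lemma near_Union_excess:
  assumes G: "finitely_generated G (carrier G)"
    and H: "finitely_generated G H" and K: "finitely_generated G K"
    and U: "essential H U" and V: "essential K V"
  shows "near (\<Union>g\<in>{g \<in> carrier G. ai_le (H, U) (conjugate g K, g <# V)}. U - (g <# V)) H"
proof -
  note DU = essentialD[OF U] and DV = essentialD[OF V]
  obtain D where D: "finite D" "D \<subseteq> carrier G"
    "\<And>g. \<lbrakk>g \<in> carrier G; \<not> nested G U (g <# V)\<rbrakk> \<Longrightarrow> \<exists>h\<in>H. \<exists>d\<in>D. \<exists>k\<in>K. g = h \<otimes> d \<otimes> k"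
    using nested_outside_finitely_many_double_cosets[OF G H K U V] by metis
  define X where "X = (\<Union>d\<in>{d \<in> D. near (U - (d <# V)) H}. U - (d <# V))"
  have "near X H" unfolding X_def using D(1) by (intro near_UN) auto
  then have "near {p \<in> carrier G. \<exists>h\<in>H. h \<otimes> p \<in> X} H" by (rule near_saturate[OF DU(1)])
  then show ?thesis
  proof (rule near_mono[OF _ _ subset_refl], intro subsetI)
    fix p assume "p \<in> (\<Union>g\<in>{g \<in> carrier G. ai_le (H, U) (conjugate g K, g <# V)}. U - (g <# V))"
    then obtain g where g: "g \<in> carrier G" "ai_le (H, U) (conjugate g K, g <# V)" "p \<in> U" "p \<notin> g <# V" by blast
    have "\<not> nested G U (g <# V)"
      using subset_if_nested_ai_le[OF U essential_translate[OF g(1) V] g(2)] g(3,4) by blast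
    then obtain h d k where hdk: "h \<in> H" "d \<in> D" "k \<in> K" "g = h \<otimes> d \<otimes> k" using D(3) g(1) by metis
    have G: "h \<in> carrier G" "d \<in> carrier G" "k \<in> carrier G" "p \<in> carrier G"
      using hdk DU DV D(2) g(3) by auto
    have "g <# V = (h \<otimes> d) <# (k <# V)" using hdk(4) G DV(2) by (simp add: lcos_m_assoc)
    then have gV: "g <# V = h <# (d <# V)" using l_coset_stable[OF V hdk(3)] G DV(2) by (simp add: lcos_m_assoc)
    have dV: "d <# V \<subseteq> carrier G" using G DV(2) l_coset_subset_G by blast
    have UdV: "U - (d <# V) \<subseteq> carrier G" using DU(2) by auto
    have "U - (g <# V) = h <# (U - (d <# V))"
      unfolding gV l_coset_Diff[OF G(1) DU(2) dV] l_coset_stable[OF U hdk(1)] ..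
    moreover have "near (U - (g <# V)) H" using g(2) by (simp add: ai_le.simps)
    ultimately have "near (U - (d <# V)) H"
      using near_translate_iff[OF G(1) DU(7) UdV] conjugate_stable[OF DU(1) hdk(1)] by simp
    moreover have "inv h \<otimes> p \<in> U - (d <# V)"
    proof -
      have "p \<in> h <# (U - (d <# V))" using g \<open>U - (g <# V) = h <# (U - (d <# V))\<close> by blast
      then show ?thesis using mem_l_coset_iff[OF G(1) UdV] by simp
    qed
    ultimately have "inv h \<otimes> p \<in> X" using hdk(2) by (auto simp: X_def)
    then show "p \<in> {p \<in> carrier G. \<exists>h\<in>H. h \<otimes> p \<in> X}"
      using subgroup.m_inv_closed[OF DU(1) hdk(1)] G(4) by blast
  qed
qed

lemma essential_perturb:
  assumes U: "essential H U" and Z: "Z \<subseteq> carrier G" "\<And>h z. \<lbrakk>h \<in> H; z \<in> Z\<rbrakk> \<Longrightarrow> h \<otimes> z \<in> Z"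
    and UZ: "near (U - Z) H" and ZU: "near (Z - U) H"
  shows "essential H Z"
proof -
  note D = essentialD[OF U]
  have "near {p \<in> Z. p \<otimes> g \<notin> Z} H" if g: "g \<in> carrier G" for g
  proof -
    have "near {p \<in> carrier G. p \<otimes> g \<in> U - Z} H"
      by (rule near_trans[OF near_shift[OF _ g] UZ]) auto
    then have "near ((Z - U) \<union> {p \<in> U. p \<otimes> g \<notin> U} \<union> {p \<in> carrier G. p \<otimes> g \<in> U - Z}) H"
      using near_Un ZU D(4)[OF g] by blast
    then show ?thesis by (rule near_mono[OF _ _ subset_refl]) (use Z(1) in auto)
  qed
  moreover have "\<not> near Z H"
  proof
    assume "near Z H"
    then have "near ((U - Z) \<union> Z) H" using near_Un UZ by blast
    then have "near U H" by (rule near_mono[OF _ _ subset_refl]) auto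
    then show False using D(5) by simp
  qed
  moreover have "\<not> near (carrier G - Z) H"
  proof
    assume "near (carrier G - Z) H"
    then have "near ((Z - U) \<union> (carrier G - Z)) H" using near_Un ZU by blast
    then have "near (carrier G - U) H" by (rule near_mono[OF _ _ subset_refl]) auto
    then show False using D(6) by simp
  qed
  ultimately show ?thesis using D(1) Z unfolding essential_def by blast
qed

end

section \<open>Sets read off an orientation\<close>

text \<open>
  A \<open>G\<close>-invariant family \<open>E\<close> of almost invariant sets, each carried along with its group, and a choice
  \<open>v\<close> of one set from each complementary pair, upward closed for the order.  The condition \<open>principal\<close>
  ties \<open>v\<close> to the identity element wherever the order lets the identity decide, and \<open>excess\<close> makes the
  exceptions few.
\<close>
locale oriented_translates = group G for G (structure) +
  fixes E :: "('a set \<times> 'a set) set" and v :: "('a set \<times> 'a set) set"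
  assumes essential_E: "(S, U) \<in> E \<Longrightarrow> essential S U"
    and translate_E: "\<lbrakk>g \<in> carrier G; (S, U) \<in> E\<rbrakk> \<Longrightarrow> (conjugate g S, g <# U) \<in> E"
    and complement_E: "(S, U) \<in> E \<Longrightarrow> (S, carrier G - U) \<in> E"
    and upward_closed: "\<lbrakk>x \<in> v; y \<in> E; ai_le x y\<rbrakk> \<Longrightarrow> y \<in> v"
    and complete: "(S, U) \<in> E \<Longrightarrow> (S, carrier G - U) \<in> v \<longleftrightarrow> (S, U) \<notin> v"
    and principal: "\<lbrakk>(S, U) \<in> E; \<And>T V. \<lbrakk>(T, V) \<in> E; ai_le (S, U) (T, V)\<rbrakk> \<Longrightarrow> \<one> \<in> V\<rbrakk> \<Longrightarrow> (S, U) \<in> v"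
    and excess: "(S, U) \<in> E \<Longrightarrow> near (\<Union>(T, V)\<in>{y \<in> E. ai_le (S, U) y}. U - V) S"
begin

text \<open>
  If \<open>v\<close> consisted of all members of the family that contain the identity, this would be the set itself, for
  \<open>g \<in> U\<close> means that the identity lies in \<open>g\<^sup>-\<^sup>1U\<close>.
\<close>
definition reading :: "'a set \<times> 'a set \<Rightarrow> 'a set" where
  "reading x = {g \<in> carrier G. (conjugate (inv g) (fst x), inv g <# snd x) \<in> v}"

lemma reading_subset: "reading x \<subseteq> carrier G"
  by (auto simp: reading_def)

lemma reading_translate:
  assumes g: "g \<in> carrier G" and x: "(S, U) \<in> E"
  shows "reading (conjugate g S, g <# U) = g <# reading (S, U)"
proof -
  note D = essentialD[OF essential_E[OF x]]
  have "p \<in> reading (conjugate g S, g <# U) \<longleftrightarrow> inv g \<otimes> p \<in> reading (S, U)" if p: "p \<in> carrier G" for p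
  proof -
    have inv: "inv (inv g \<otimes> p) = inv p \<otimes> g" using g p by (simp add: inv_mult_group)
    have "conjugate (inv p) (conjugate g S) = conjugate (inv (inv g \<otimes> p)) S"
      unfolding inv by (rule conjugate_conjugate[OF inv_closed[OF p] g D(7)])
    moreover have "inv p <# (g <# U) = inv (inv g \<otimes> p) <# U"
      unfolding inv by (rule lcos_m_assoc[OF D(2) inv_closed[OF p] g])
    ultimately show ?thesis using g p unfolding reading_def by simp
  qed
  then show ?thesis using mem_l_coset_iff[OF g reading_subset] reading_subset by blast
qed

lemma reading_complement:
  assumes x: "(S, U) \<in> E"
  shows "reading (S, carrier G - U) = carrier G - reading (S, U)"
proof -
  have "(conjugate (inv g) S, inv g <# (carrier G - U)) \<in> v \<longleftrightarrow> (conjugate (inv g) S, inv g <# U) \<notin> v"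
    if g: "g \<in> carrier G" for g
    using complete[OF translate_E[OF inv_closed[OF g] x]] l_coset_complement[of "inv g" U]
      essentialD(2)[OF essential_E[OF x]] g by simp
  then show ?thesis by (auto simp: reading_def)
qed

lemma reading_mono:
  assumes x: "(S, U) \<in> E" and y: "(T, V) \<in> E" and le: "ai_le (S, U) (T, V)"
  shows "reading (S, U) \<subseteq> reading (T, V)"
proof
  fix g assume "g \<in> reading (S, U)"
  then have g: "inv g \<in> carrier G" "g \<in> carrier G" "(conjugate (inv g) S, inv g <# U) \<in> v"
    by (auto simp: reading_def)
  have "(conjugate (inv g) T, inv g <# V) \<in> v"
    using upward_closed[OF g(3) translate_E[OF g(1) y]]
      ai_le_translate_iff[OF g(1) essential_E[OF x] essential_E[OF y]] le by blast
  then show "g \<in> reading (T, V)" using g by (simp add: reading_def)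
qed

text \<open>
  If \<open>g\<close> belongs to \<open>U\<close> but not to its reading, then the identity fails to decide for \<open>g\<^sup>-\<^sup>1U\<close>: some larger
  member of the family omits it.  Translating back, \<open>g\<close> lies in the excess of \<open>U\<close> over a larger member.
\<close>
lemma near_missing:
  assumes x: "(S, U) \<in> E" shows "near (U - reading (S, U)) S"
proof (rule near_mono[OF excess[OF x] _ subset_refl], rule subsetI)
  fix g assume g: "g \<in> U - reading (S, U)"
  note D = essentialD[OF essential_E[OF x]]
  have gG: "g \<in> carrier G" "inv g \<in> carrier G" using g D(2) by auto
  have "(conjugate (inv g) S, inv g <# U) \<notin> v" using g gG by (simp add: reading_def)
  then obtain T V where y: "(T, V) \<in> E" "ai_le (conjugate (inv g) S, inv g <# U) (T, V)" "\<one> \<notin> V"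
    using principal[OF translate_E[OF gG(2) x]] by blast
  note DV = essentialD[OF essential_E[OF y(1)]]
  have "ai_le (conjugate g (conjugate (inv g) S), g <# (inv g <# U)) (conjugate g T, g <# V)"
    using ai_le_translate_iff[OF gG(1) essential_E[OF translate_E[OF gG(2) x]] essential_E[OF y(1)]] y(2) by simp
  then have le: "ai_le (S, U) (conjugate g T, g <# V)"
    using conjugate_conjugate[OF gG D(7)] conjugate_one[OF D(7)] lcos_m_assoc[OF D(2) gG] lcos_mult_one[OF D(2)] gG(1)
    by (metis r_inv)
  have "g \<notin> g <# V" using mem_l_coset_iff[OF gG(1) DV(2)] gG y(3) by simp
  then show "g \<in> (\<Union>(T, V)\<in>{y \<in> E. ai_le (S, U) y}. U - V)"
    using translate_E[OF gG(1) y(1)] le g by blast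
qed

text \<open>
  Points gained by \<open>U\<close> are points lost by its complement.
\<close>
lemma near_extra:
  assumes x: "(S, U) \<in> E" shows "near (reading (S, U) - U) S"
proof -
  have "carrier G - U - reading (S, carrier G - U) = reading (S, U) - U"
    using reading_complement[OF x] reading_subset[of "(S, U)"] by auto
  then show ?thesis using near_missing[OF complement_E[OF x]] by simp
qed

lemma essential_reading:
  assumes x: "(S, U) \<in> E" shows "essential S (reading (S, U))"
proof (rule essential_perturb[OF essential_E[OF x] reading_subset _ near_missing[OF x] near_extra[OF x]])
  fix h z assume h: "h \<in> S" and z: "z \<in> reading (S, U)"
  note D = essentialD[OF essential_E[OF x]]
  have "h \<in> carrier G" using h D by auto
  then have "h <# reading (S, U) = reading (S, U)"
    using reading_translate[OF _ x] conjugate_stable[OF D(1) h] l_coset_stable[OF essential_E[OF x] h] by metis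
  then show "h \<otimes> z \<in> reading (S, U)" using z by (auto simp: l_coset_def)
qed

text \<open>
  A small corner of the readings gives a small corner of the original sets, since each set differs
  little from its reading and smallness can be transferred between the two groups.  The original sets
  are then comparable, and the reading is monotone.
\<close>
lemma reading_small_corner:
  assumes x: "(S, U) \<in> E" and y: "(T, V) \<in> E" and small: "near (reading (S, U) \<inter> reading (T, V)) S"
  shows "reading (S, U) \<inter> reading (T, V) = {} \<or>
    (carrier G - reading (S, U)) \<inter> (carrier G - reading (T, V)) = {}"
proof -
  note U = essential_E[OF x] and V = essential_E[OF y] and V' = essential_E[OF complement_E[OF y]]
  let ?X = "reading (S, U)" and ?Y = "reading (T, V)"
  have "near ((U - ?X) \<union> (?X \<inter> ?Y)) S" using near_Un near_missing[OF x] small by blast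
  then have "near (U \<inter> ?Y) S" by (rule near_mono[OF _ _ subset_refl]) auto
  then have "near (U \<inter> ?Y) T" by (rule small_sym[OF U essential_reading[OF y]])
  then have "near ((U \<inter> ?Y) \<union> (V - ?Y)) T" using near_Un near_missing[OF y] by blast
  then have "near (V \<inter> U) T" by (rule near_mono[OF _ _ subset_refl]) auto
  then have "near (V \<inter> U) S" by (rule small_sym[OF V U])
  moreover have "V \<inter> U = U - (carrier G - V)" using essentialD(2)[OF U] essentialD(2)[OF V] by auto
  ultimately have "near (U - (carrier G - V)) S" by simp
  then consider "ai_le (S, U) (T, carrier G - V)" | "ai_le (T, carrier G - V) (S, U)"
    using ai_le_linear[OF U V'] by blast
  then show ?thesis
  proof cases
    case 1
    then show ?thesis using reading_mono[OF x complement_E[OF y]] reading_complement[OF y] by blast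
  next
    case 2
    then show ?thesis using reading_mono[OF complement_E[OF y] x] reading_complement[OF y] by blast
  qed
qed

lemma reading_nested_or_crosses:
  assumes x: "(S, U) \<in> E" and y: "(T, V) \<in> E"
  shows "crosses G S (reading (S, U)) T (reading (T, V)) \<or> nested G (reading (S, U)) (reading (T, V))"
proof (rule disjCI)
  assume not_nested: "\<not> nested G (reading (S, U)) (reading (T, V))"
  let ?X = "reading (S, U)" and ?Y = "reading (T, V)"
  note S = essentialD(1)[OF essential_E[OF x]] and T = essentialD(1)[OF essential_E[OF y]]
  have ne: "?X \<inter> ?Y \<noteq> {}" "(carrier G - ?X) \<inter> ?Y \<noteq> {}" "?X \<inter> (carrier G - ?Y) \<noteq> {}"
    "(carrier G - ?X) \<inter> (carrier G - ?Y) \<noteq> {}"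
    using not_nested unfolding nested_def corners_def by blast+
  have compl: "carrier G - (carrier G - ?X) = ?X" "carrier G - (carrier G - ?Y) = ?Y"
    using reading_subset by auto
  have "\<not> near C S" if "C \<in> corners G ?X ?Y" for C
    using that ne compl reading_small_corner[OF x y] reading_small_corner[OF complement_E[OF x] y]
      reading_small_corner[OF x complement_E[OF y]]
      reading_small_corner[OF complement_E[OF x] complement_E[OF y]]
    unfolding corners_def reading_complement[OF x] reading_complement[OF y] by auto
  then show "crosses G S ?X T ?Y"
    using essential_iff[OF S] essential_iff[OF T] essential_reading[OF x] essential_reading[OF y]
      H_finite_iff_near[OF S] by (simp add: crosses_def)
qed

end

section \<open>Orienting the translates\<close>

lemma (in group) translatesI:
  assumes "g \<in> carrier G" "i \<in> {1..n}" "Y = A i \<or> Y = carrier G - A i"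
  shows "(conjugate g (H i), g <# Y) \<in> translates G n H A"
  using assms unfolding translates_def by fast

lemma (in group) translates_essential:
  assumes A: "\<And>i. i \<in> {1..n} \<Longrightarrow> essential (H i) (A i)" and x: "(S, U) \<in> translates G n H A"
  obtains g i Y where "g \<in> carrier G" "i \<in> {1..n}" "Y = A i \<or> Y = carrier G - A i" "essential (H i) Y"
    "S = conjugate g (H i)" "U = g <# Y"
proof -
  obtain g i where gi: "g \<in> carrier G" "i \<in> {1..n}" "S = conjugate g (H i)"
    "U = g <# A i \<or> U = g <# (carrier G - A i)"
    using x by (auto simp: translates_def)
  then show thesis using that[OF gi(1,2) _ _ gi(3)] A[OF gi(2)] essential_complement by metis
qed

lemma (in group) translates_translate:
  assumes A: "\<And>i. i \<in> {1..n} \<Longrightarrow> essential (H i) (A i)"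
    and g: "g \<in> carrier G" and x: "(S, U) \<in> translates G n H A"
  shows "(conjugate g S, g <# U) \<in> translates G n H A"
proof -
  obtain k i Y where Y: "k \<in> carrier G" "i \<in> {1..n}" "Y = A i \<or> Y = carrier G - A i" "essential (H i) Y"
    "S = conjugate k (H i)" "U = k <# Y"
    using translates_essential[OF A x] by metis
  have "conjugate g S = conjugate (g \<otimes> k) (H i)" "g <# U = (g \<otimes> k) <# Y"
    using Y g essentialD[OF Y(4)] by (simp_all add: conjugate_conjugate lcos_m_assoc)
  then show ?thesis using translatesI[of "g \<otimes> k" i n Y A H] Y(1-3) g by simp
qed

lemma (in group) translates_complement:
  assumes A: "\<And>i. i \<in> {1..n} \<Longrightarrow> essential (H i) (A i)" and x: "(S, U) \<in> translates G n H A"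
  shows "(S, carrier G - U) \<in> translates G n H A"
proof -
  obtain k i Y where Y: "k \<in> carrier G" "i \<in> {1..n}" "Y = A i \<or> Y = carrier G - A i" "essential (H i) Y"
    "S = conjugate k (H i)" "U = k <# Y"
    using translates_essential[OF A x] by metis
  have "carrier G - U = k <# (carrier G - Y)" using l_coset_complement Y essentialD(2)[OF Y(4)] by simp
  moreover have "carrier G - Y = carrier G - A i \<or> carrier G - Y = A i"
    using Y(3) essentialD(2)[OF A[OF Y(2)]] by auto
  ultimately show ?thesis using translatesI[of k i n "carrier G - Y" A H] Y(1,2,5) by auto
qed

text \<open>
  After translation the smaller set is one of finitely many, and so is the larger one up to
  translation; hence finitely many applications of \<open>near_Union_excess\<close> suffice.
\<close>
lemma (in group) near_excess_translates:
  assumes G: "finitely_generated G (carrier G)"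
    and H: "\<And>i. i \<in> {1..n} \<Longrightarrow> finitely_generated G (H i)"
    and A: "\<And>i. i \<in> {1..n} \<Longrightarrow> essential (H i) (A i)"
    and x: "(S, U) \<in> translates G n H A"
  shows "near (\<Union>(T, V)\<in>{y \<in> translates G n H A. ai_le (S, U) y}. U - V) S"
proof -
  let ?E = "translates G n H A"
  obtain g i Y where Y: "g \<in> carrier G" "i \<in> {1..n}" "Y = A i \<or> Y = carrier G - A i" "essential (H i) Y"
    "S = conjugate g (H i)" "U = g <# Y"
    using translates_essential[OF A x] by metis
  note DY = essentialD[OF Y(4)]
  define B where "B = (\<lambda>(j, c). if c then A j else carrier G - A j)"
  \<comment> \<open>The excess of \<open>Y\<close> over translates of each \<open>A\<^sub>j\<close> and of its complement.\<close>
  define X where "X = (\<Union>(j, c)\<in>{1..n} \<times> (UNIV :: bool set).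
    \<Union>k\<in>{k \<in> carrier G. ai_le (H i, Y) (conjugate k (H j), k <# B (j, c))}. Y - (k <# B (j, c)))"
  have B: "essential (H j) (B (j, c))" if "j \<in> {1..n}" for j c
    using A[OF that] essential_complement by (simp add: B_def)
  have "near X (H i)"
    unfolding X_def
  proof (rule near_UN)
    fix jc assume "jc \<in> {1..n} \<times> (UNIV :: bool set)"
    then obtain j c where "jc = (j, c)" "j \<in> {1..n}" by auto
    then show "near (case jc of (j, c) \<Rightarrow> \<Union>k\<in>{k \<in> carrier G. ai_le (H i, Y) (conjugate k (H j), k <# B (j, c))}.
        Y - (k <# B (j, c))) (H i)"
      using near_Union_excess[OF G H[OF Y(2)] H[of j] Y(4) B] by simp
  qed simp
  then have "near (g <# X) S" unfolding Y(5) by (rule near_translate[OF Y(1) DY(7)])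
  then show ?thesis
  proof (rule near_mono[OF _ _ subset_refl], intro subsetI)
    fix p assume "p \<in> (\<Union>(T, V)\<in>{y \<in> ?E. ai_le (S, U) y}. U - V)"
    then obtain T V where TV: "(T, V) \<in> ?E" "ai_le (S, U) (T, V)" "p \<in> U" "p \<notin> V" by blast
    obtain k j Y' where Y': "k \<in> carrier G" "j \<in> {1..n}" "Y' = A j \<or> Y' = carrier G - A j" "essential (H j) Y'"
      "T = conjugate k (H j)" "V = k <# Y'"
      using translates_essential[OF A TV(1)] by metis
    note DY' = essentialD[OF Y'(4)]
    have "Y' = B (j, True) \<or> Y' = B (j, False)" using Y'(3) by (auto simp: B_def)
    then obtain c where c: "Y' = B (j, c)" by blast
    define l where "l = inv g \<otimes> k"
    have l: "l \<in> carrier G" "g \<otimes> l = k" using Y(1) Y'(1) by (simp_all add: l_def m_assoc[symmetric])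
    have T: "T = conjugate g (conjugate l (H j))" using conjugate_conjugate[OF Y(1) l(1) DY'(7)] l(2) Y'(5) by simp
    have V: "V = g <# (l <# Y')" using lcos_m_assoc[OF DY'(2) Y(1) l(1)] l(2) Y'(6) by simp
    have le: "ai_le (H i, Y) (conjugate l (H j), l <# B (j, c))"
      using TV(2) ai_le_translate_iff[OF Y(1,4) essential_translate[OF l(1) Y'(4)]] unfolding T V Y(5,6) c by simp
    have lY': "l <# Y' \<subseteq> carrier G" using l(1) DY'(2) l_coset_subset_G by blast
    have "p \<in> g <# (Y - (l <# Y'))"
      using TV(3,4) l_coset_Diff[OF Y(1) DY(2) lY'] V Y(6) by simp
    moreover have "Y - (l <# Y') \<subseteq> X"
      unfolding X_def c using l(1) le Y'(2) by blast
    ultimately show "p \<in> g <# X" by (auto simp: l_coset_def)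
  qed
qed

text \<open>
  The sets all of whose larger members contain the identity form a consistent upper set \<open>W\<close>, because
  two complementary sets cannot both contain the identity.  Any completion of \<open>W\<close> will do.
\<close>
lemma (in group) exists_oriented_translates:
  assumes G: "finitely_generated G (carrier G)"
    and H: "\<And>i. i \<in> {1..n} \<Longrightarrow> finitely_generated G (H i)"
    and A: "\<And>i. i \<in> {1..n} \<Longrightarrow> essential (H i) (A i)"
  obtains v where "oriented_translates G (translates G n H A) v"
proof -
  let ?E = "translates G n H A"
  have ess: "essential S U" if x: "(S, U) \<in> ?E" for S U
    using translates_essential[OF A x] essential_translate by metis
  have compl: "(S, carrier G - U) \<in> ?E" if x: "(S, U) \<in> ?E" for S U
    using translates_complement[OF A x] by simp
  define star where "star = (\<lambda>(S :: 'a set, U). (S, carrier G - U))"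
  define W where "W = {x \<in> ?E. \<forall>y\<in>?E. ai_le x y \<longrightarrow> \<one> \<in> snd y}"
  have "\<exists>v. W \<subseteq> v \<and> v \<subseteq> ?E \<and> (\<forall>x\<in>v. \<forall>y\<in>?E. ai_le x y \<longrightarrow> y \<in> v) \<and> (\<forall>x\<in>?E. (star x \<in> v) = (x \<notin> v))"
  proof (rule complete_upset_extension)
    show "ai_le x x" for x using ai_le_refl by (cases x) simp
    show trans: "ai_le x z" if "x \<in> ?E" "y \<in> ?E" "z \<in> ?E" "ai_le x y" "ai_le y z" for x y z
      using that ess ai_le_trans by (cases x; cases y; cases z) blast
    show "star x \<in> ?E" if "x \<in> ?E" for x
      using that compl by (cases x) (simp add: star_def)
    show "star (star x) = x" if "x \<in> ?E" for x
      using that essentialD(2)[OF ess] by (cases x) (auto simp: star_def)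
    show "ai_le (star y) (star x)" if "x \<in> ?E" "y \<in> ?E" "ai_le x y" for x y
      using that ess ai_le_complement by (cases x; cases y) (auto simp: star_def)
    show "\<not> ai_le x (star x)" if "x \<in> ?E" for x
      using that ess not_ai_le_complement by (cases x) (auto simp: star_def)
    show "W \<subseteq> ?E" by (auto simp: W_def)
    show "y \<in> W" if "x \<in> W" "y \<in> ?E" "ai_le x y" for x y
      using that trans unfolding W_def by blast
    show "star x \<notin> W" if "x \<in> W" for x
    proof
      obtain S U where x: "x = (S, U)" by (cases x)
      assume "star x \<in> W"
      then have "\<one> \<in> U" "\<one> \<in> carrier G - U"
        using that ai_le_refl[of S U] ai_le_refl[of S "carrier G - U"] by (auto simp: x W_def star_def)
      then show False by simp
    qed
  qed
  then obtain v where v: "W \<subseteq> v" "\<And>x y. \<lbrakk>x \<in> v; y \<in> ?E; ai_le x y\<rbrakk> \<Longrightarrow> y \<in> v"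
    "\<And>x. x \<in> ?E \<Longrightarrow> (star x \<in> v) = (x \<notin> v)" by blast
  have "oriented_translates G ?E v"
  proof unfold_locales
    show "(S, U) \<in> ?E \<Longrightarrow> essential S U" for S U by (rule ess)
    show "(conjugate g S, g <# U) \<in> ?E" if "g \<in> carrier G" "(S, U) \<in> ?E" for g S U
      using translates_translate[OF A] that by simp
    show "(S, U) \<in> ?E \<Longrightarrow> (S, carrier G - U) \<in> ?E" for S U by (rule compl)
    show "y \<in> v" if "x \<in> v" "y \<in> ?E" "ai_le x y" for x y using v(2) that .
    show "(S, carrier G - U) \<in> v \<longleftrightarrow> (S, U) \<notin> v" if "(S, U) \<in> ?E" for S U
      using v(3)[OF that] by (simp add: star_def)
    show "(S, U) \<in> v" if "(S, U) \<in> ?E" "\<And>T V. \<lbrakk>(T, V) \<in> ?E; ai_le (S, U) (T, V)\<rbrakk> \<Longrightarrow> \<one> \<in> V" for S U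
      using v(1) that by (auto simp: W_def)
    show "near (\<Union>(T, V)\<in>{y \<in> ?E. ai_le (S, U) y}. U - V) S" if "(S, U) \<in> ?E" for S U
      using near_excess_translates[OF G H A that] .
  qed
  then show thesis by (rule that)
qed

section \<open>Very good position\<close>

theorem lemma4p1:
  fixes G :: "('a, 'b) monoid_scheme"
    and n :: nat
    and H A :: "nat \<Rightarrow> 'a set"
  assumes "group G"
    and "finitely_generated G (carrier G)"
    and "\<And>i. i \<in> {1..n} \<Longrightarrow> subgroup (H i) G"
    and "\<And>i. i \<in> {1..n} \<Longrightarrow> finitely_generated G (H i)"
    and "\<And>i. i \<in> {1..n} \<Longrightarrow> nontrivial_H_almost_invariant G (H i) (A i)"
  shows "\<exists>K Z. (\<forall>i\<in>{1..n}. subgroup (K i) G \<and> H_almost_invariant G (K i) (Z i) \<and>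
             equivalent_almost_invariant G (H i) (A i) (K i) (Z i)) \<and>
           very_good_position G n K Z"
proof -
  interpret group G by (rule assms(1))
  have ess: "essential (H i) (A i)" if "i \<in> {1..n}" for i
    using essential_iff assms(3,5)[OF that] by blast
  obtain v where v: "oriented_translates G (translates G n H A) v"
    by (rule exists_oriented_translates[OF assms(2,4) ess])
  interpret oriented_translates G "translates G n H A" v by (rule v)
  define Z where "Z i = reading (H i, A i)" for i
  have base: "(H i, A i) \<in> translates G n H A" if i: "i \<in> {1..n}" for i
  proof -
    have "H i = conjugate \<one>\<^bsub>G\<^esub> (H i)" "A i = \<one>\<^bsub>G\<^esub> <#\<^bsub>G\<^esub> A i"
      using essentialD[OF ess[OF i]] by (simp_all add: conjugate_one lcos_mult_one)
    then show ?thesis using translatesI[OF one_closed i, of "A i" A H] by simp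
  qed
  have "subgroup (H i) G \<and> H_almost_invariant G (H i) (Z i) \<and>
      equivalent_almost_invariant G (H i) (A i) (H i) (Z i)" if i: "i \<in> {1..n}" for i
  proof -
    note Hi = assms(3)[OF i]
    have "H_almost_invariant G (H i) (Z i)"
      using essential_iff[OF Hi] essential_reading[OF base[OF i]]
      by (simp add: Z_def nontrivial_H_almost_invariant_def)
    moreover have "H_finite G (H i) (sym_diff (A i) (Z i))"
      using near_Un[OF near_missing[OF base[OF i]] near_extra[OF base[OF i]]] H_finite_iff_near[OF Hi]
      by (simp add: Z_def)
    ultimately show ?thesis
      using Hi assms(5)[OF i]
      by (simp add: equivalent_almost_invariant_def nontrivial_H_almost_invariant_def)
  qed
  moreover have "very_good_position G n H Z"
  proof -
    have reading: "\<exists>U. (S, U) \<in> translates G n H A \<and> X = reading (S, U)" if X: "(S, X) \<in> translates G n H Z" for S X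
    proof -
      obtain g i where gi: "g \<in> carrier G" "i \<in> {1..n}" "S = conjugate g (H i)"
        "X = g <#\<^bsub>G\<^esub> Z i \<or> X = g <#\<^bsub>G\<^esub> (carrier G - Z i)"
        using X by (auto simp: translates_def)
      note b = base[OF gi(2)] and c = complement_E[OF base[OF gi(2)]]
      have "X = reading (S, g <#\<^bsub>G\<^esub> A i) \<or> X = reading (S, g <#\<^bsub>G\<^esub> (carrier G - A i))"
        using gi(3,4) reading_translate[OF gi(1) b] reading_translate[OF gi(1) c] reading_complement[OF b]
        by (simp add: Z_def)
      then show ?thesis using translate_E[OF gi(1) b] translate_E[OF gi(1) c] gi(3) by blast
    qed
    show ?thesis
      unfolding very_good_position_def
    proof (clarify)
      fix S U T V
      assume x: "(S, U) \<in> translates G n H Z" and y: "(T, V) \<in> translates G n H Z" and "\<not> nested G U V"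
      then show "crosses G S U T V"
        using reading[OF x] reading[OF y] reading_nested_or_crosses by metis
    qed
  qed
  ultimately show ?thesis by blast
qed

end
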